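(* Let $V\in C^2(\mathbb{R},\mathbb{R})$ satisfy $V(x)\ge0$ for all $x$, $V(-1)=V(1)=0$, $V(x)>0$ for $x\in(-1,1)$, and $V''(-1),V''(1)>0$. Let $a:\mathbb{R}\to\mathbb{R}$ be bounded and continuous with $\liminf_{|t|\to\infty}a(t)=a_\infty>\inf_{t\in\mathbb{R}}a(t)=a(0)>0$. Then there is $\epsilon^*>0$ such that for all $\epsilon\in(0,\epsilon^* )$ the problem $\ddot x(t)=a(\epsilon t)V'(x(t))$, $t\in\mathbb{R}$, $x(t)\to-1$ as $t\to-\infty$, $x(t)\to1$ as $t\to+\infty$, has a solution $x\in H^1_{loc}(\mathbb{R})\cap C^2(\mathbb{R})$. Moreover, $x(t)\in(-1,1)$ for all $t\in\mathbb{R}$. *)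

theory Defs
  imports "HOL-Analysis.Analysis"
begin

definition C2 :: "(real \<Rightarrow> real) \<Rightarrow> bool" where
  "C2 f \<longleftrightarrow> (\<forall>x. f differentiable (at x)) \<and> (\<forall>x. deriv f differentiable (at x))
           \<and> continuous_on UNIV (deriv (deriv f))"

end

(* The transition from -1 to 1 is obtained as a limit of discrete action minimizers. On the grid with step
   h = 1/(n+1), the action sum (dx)^2/(2h) + h b V(x), with b(t) = a(eps t), is minimized over paths in
   [-1,1] that equal -1 far left and 1 far right; minimizers satisfy the discrete equation, also where they touch
   -1 or 1 because V' vanishes there. With G' = sqrt(2V), a transition where b >= m costs about
   sqrt(m) (G(1) - G(-1)) or more, while for small eps a transition near 0 costs barely more than sqrt(a(0)) (G(1) - G(-1)).
   Hence the minimizers make their transition in the bounded region where b is below a level m2 > a(0), and outside a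
   window independent of n they stay near the wells. The equi-Lipschitz minimizers converge pointwise along a filter,
   and Schwarz's theorem on symmetric second differences shows that the limit solves the equation. Convexity near the wells
   gives the limits at infinity, and uniqueness for the initial value problem keeps the solution off -1 and 1. *)

theory Submission
  imports Defs
begin

text \<open>The obstacle is loss of compactness: time shifts change the action only through the
  coefficient, so minimizers on growing windows could carry their transition off to infinity, or
  leave a well again at a distant time. A strict gap in cost rules this out. A path that crosses
  where \<open>b\<close> is at least \<open>m2\<close>, or makes an extra excursion of size
  \<open>\<eta>1\<close> out of a well, costs about \<open>thr\<close> or more, while some
  competitor costs little more than \<open>sqrt m * \<sigma>\<close>. The constants
  \<open>U'\<close> and \<open>U\<close> lie inside this gap. The bound \<open>\<epsilon>s\<close>
  only has to ensure that the competitor, whose crossing takes time about \<open>2 / \<tau>\<close>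
  at most, sees the coefficient below \<open>\<beta>\<^sup>2\<close>. The limit is never shown to
  minimize anything: only the discrete equation and the two one-sided bounds near the wells are
  passed to it. A single parameter \<open>n\<close> drives the approximation, since mesh 1/(n+1)
  with (n+1)^2 cells on each side of 0 covers the times from -(n+1) to n+1.\<close>

lemma continuous_antiderivative:
  fixes f :: "real \<Rightarrow> real"
  assumes "continuous_on UNIV f"
  shows "\<exists>F. \<forall>t. (F has_real_derivative f t) (at t)"
proof -
  have "\<exists>F. \<forall>x :: real. -\<infinity> < ereal x \<longrightarrow> ereal x < \<infinity> \<longrightarrow> (F has_vector_derivative f x) (at x)"
    by (rule einterval_antiderivative) (use assms in \<open>auto simp: continuous_on_eq_continuous_at\<close>)
  then show ?thesis
    by (simp add: has_real_derivative_iff_has_vector_derivative)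
qed

text \<open>Schwarz's maximum argument. Adding a small convex parabola that vanishes at both ends
  keeps a positive interior maximum \<open>c\<close>. There the second difference of the sum is at
  most 0 while the parabola contributes \<open>2 * \<kappa> * s\<^sup>2\<close>, so that of
  \<open>y\<close> is at most \<open>- 2 * \<kappa> * s\<^sup>2\<close>, too negative for the
  hypothesis with \<open>\<rho> = \<kappa>\<close>.\<close>

lemma symmetric_second_difference_nonpos:
  fixes y :: "real \<Rightarrow> real"
  assumes cont: "continuous_on UNIV y"
    and sym: "\<And>t \<rho>. \<rho> > 0 \<Longrightarrow> \<exists>r>0. \<forall>s. 0 < s \<and> s < r \<longrightarrow> \<bar>y (t + s) + y (t - s) - 2 * y t\<bar> \<le> \<rho> * s\<^sup>2"
    and ends: "y \<alpha> = 0" "y \<beta> = 0" and \<gamma>: "\<alpha> < \<gamma>" "\<gamma> < \<beta>"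
  shows "y \<gamma> \<le> 0"
proof (rule ccontr)
  assume "\<not> y \<gamma> \<le> 0"
  then have pos: "y \<gamma> > 0" by simp
  \<comment> \<open>On the interval the parabola is at least
    \<open>- \<kappa> * (\<beta> - \<alpha>)\<^sup>2\<close>, so this choice costs at most half of
    \<open>y \<gamma>\<close>.\<close>
  define \<kappa> where "\<kappa> = y \<gamma> / (2 * (\<beta> - \<alpha>)\<^sup>2)"
  have \<kappa>: "\<kappa> > 0" using pos \<gamma> by (simp add: \<kappa>_def)
  define z where "z t = y t + \<kappa> * ((t - \<alpha>) * (t - \<beta>))" for t
  have "continuous_on {\<alpha>..\<beta>} z"
    unfolding z_def by (intro continuous_intros continuous_on_subset[OF cont]) auto
  then obtain c where c: "c \<in> {\<alpha>..\<beta>}" and cmax: "\<And>t. t \<in> {\<alpha>..\<beta>} \<Longrightarrow> z t \<le> z c"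
    using continuous_attains_sup[of "{\<alpha>..\<beta>}" z] \<gamma> by auto
  have "(\<gamma> - \<alpha>) * (\<beta> - \<gamma>) \<le> (\<beta> - \<alpha>) * (\<beta> - \<alpha>)"
    using \<gamma> by (intro mult_mono) auto
  then have "\<kappa> * ((\<gamma> - \<alpha>) * (\<beta> - \<gamma>)) \<le> \<kappa> * (\<beta> - \<alpha>)\<^sup>2"
    using \<kappa> by (simp add: power2_eq_square)
  also have "\<dots> = y \<gamma> / 2" using \<gamma> by (simp add: \<kappa>_def)
  finally have "z \<gamma> > 0"
    using pos unfolding z_def by (simp add: algebra_simps)
  then have zc: "z c > 0" using cmax[of \<gamma>] \<gamma> by auto
  have "c \<noteq> \<alpha>" "c \<noteq> \<beta>" using zc ends by (auto simp: z_def)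
  then have c': "\<alpha> < c" "c < \<beta>" using c by auto
  obtain r where r: "r > 0" "\<And>s. 0 < s \<Longrightarrow> s < r \<Longrightarrow> \<bar>y (c + s) + y (c - s) - 2 * y c\<bar> \<le> \<kappa> * s\<^sup>2"
    using sym[OF \<kappa>, of c] by blast
  define s where "s = min (r / 2) (min (c - \<alpha>) (\<beta> - c))"
  have s: "0 < s" "s < r" "s \<le> c - \<alpha>" "s \<le> \<beta> - c" using r c' by (auto simp: s_def)
  have "z (c + s) \<le> z c" "z (c - s) \<le> z c" using s by (auto intro!: cmax)
  moreover have "z (c + s) + z (c - s) - 2 * z c = (y (c + s) + y (c - s) - 2 * y c) + 2 * \<kappa> * s\<^sup>2"
    by (simp add: z_def algebra_simps power2_eq_square)
  ultimately have "2 * (\<kappa> * s\<^sup>2) \<le> \<bar>y (c + s) + y (c - s) - 2 * y c\<bar>" by linarith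
  with r(2)[OF s(1,2)] \<kappa> s(1) show False by (smt (verit) zero_less_mult_iff zero_less_power)
qed

text \<open>Subtracting a chord does not change second differences, so the one-sided result applies
  to \<open>y\<close> minus its chord and to the negative of this. Any three points of the graph are
  therefore collinear.\<close>

lemma symmetric_second_difference_zero_affine:
  fixes y :: "real \<Rightarrow> real"
  assumes cont: "continuous_on UNIV y"
    and sym: "\<And>t \<rho>. \<rho> > 0 \<Longrightarrow> \<exists>r>0. \<forall>s. 0 < s \<and> s < r \<longrightarrow> \<bar>y (t + s) + y (t - s) - 2 * y t\<bar> \<le> \<rho> * s\<^sup>2"
  obtains c d where "\<And>t. y t = c + d * t"
proof -
  have chord: "(y \<beta> - y \<alpha>) * (\<gamma> - \<alpha>) = (y \<gamma> - y \<alpha>) * (\<beta> - \<alpha>)"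
    if \<gamma>: "\<alpha> < \<gamma>" "\<gamma> < \<beta>" for \<alpha> \<beta> \<gamma>
  proof -
    define m where "m = (y \<beta> - y \<alpha>) / (\<beta> - \<alpha>)"
    define w where "w t = y t - y \<alpha> - m * (t - \<alpha>)" for t
    have m: "m * (\<beta> - \<alpha>) = y \<beta> - y \<alpha>" using \<gamma> by (simp add: m_def)
    have w0: "w \<alpha> = 0" "w \<beta> = 0" using m by (auto simp: w_def)
    have cw: "continuous_on UNIV w" unfolding w_def by (intro continuous_intros cont)
    have eq: "w (t + s) + w (t - s) - 2 * w t = y (t + s) + y (t - s) - 2 * y t" for t s
      by (simp add: w_def algebra_simps)
    have eq2: "\<bar>- w (t + s) + - w (t - s) - 2 * - w t\<bar> = \<bar>y (t + s) + y (t - s) - 2 * y t\<bar>" for t s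
      using eq[of t s] by linarith
    have "w \<gamma> \<le> 0"
      by (rule symmetric_second_difference_nonpos[OF cw _ w0 \<gamma>]) (simp only: eq sym)
    moreover have "- w \<gamma> \<le> 0"
    proof (rule symmetric_second_difference_nonpos[of "\<lambda>t. - w t", OF _ _ _ _ \<gamma>])
      show "continuous_on UNIV (\<lambda>t. - w t)" by (intro continuous_intros cw)
      show "\<exists>r>0. \<forall>s. 0 < s \<and> s < r \<longrightarrow> \<bar>- w (t + s) + - w (t - s) - 2 * - w t\<bar> \<le> \<rho> * s\<^sup>2"
        if "\<rho> > 0" for t \<rho>
        unfolding eq2 by (rule sym[OF that])
    qed (simp_all add: w0)
    ultimately have "y \<gamma> - y \<alpha> = m * (\<gamma> - \<alpha>)" by (simp add: w_def)
    then have "(y \<gamma> - y \<alpha>) * (\<beta> - \<alpha>) = (m * (\<beta> - \<alpha>)) * (\<gamma> - \<alpha>)" by simp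
    then show ?thesis using m by simp
  qed
  have "y t = y 0 + (y 1 - y 0) * t" for t
  proof -
    consider "t < 0" | "t = 0" | "0 < t" "t < 1" | "t = 1" | "1 < t" by linarith
    then show ?thesis
    proof cases
      case 1 then show ?thesis using chord[of t 0 1] by (simp add: algebra_simps)
    next
      case 3 then show ?thesis using chord[of 0 t 1] by (simp add: algebra_simps)
    next
      case 5 then show ?thesis using chord[of 0 1 t] by (simp add: algebra_simps)
    qed auto
  qed
  then show ?thesis using that by blast
qed

text \<open>The error, as a function of the step, has derivative
  \<open>F1 (t + u) - F1 (t - u) - 2 * c * u\<close>, which is small relative to \<open>u\<close> by
  differentiability of \<open>F1\<close> at the single point \<open>t\<close>; the mean value
  theorem supplies the second factor \<open>s\<close>.\<close>

lemma symmetric_second_difference_antiderivative: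
  fixes F1 F2 :: "real \<Rightarrow> real"
  assumes F2: "\<And>t. (F2 has_real_derivative F1 t) (at t)"
    and F1: "(F1 has_real_derivative c) (at t)" and \<rho>: "\<rho> > 0"
  shows "\<exists>r>0. \<forall>s. 0 < s \<and> s < r \<longrightarrow> \<bar>F2 (t + s) + F2 (t - s) - 2 * F2 t - c * s\<^sup>2\<bar> \<le> \<rho> * s\<^sup>2"
proof -
  have "(F1 has_derivative (\<lambda>x. x * c)) (at t)"
    by (rule has_derivative_eq_rhs[OF F1[unfolded has_field_derivative_def]]) (simp add: fun_eq_iff)
  then have "\<exists>r>0. \<forall>u. \<bar>u - t\<bar> < r \<longrightarrow> \<bar>F1 u - F1 t - (u - t) * c\<bar> \<le> \<rho> / 2 * \<bar>u - t\<bar>"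
    unfolding has_derivative_within_alt real_norm_def using half_gt_zero[OF \<rho>] by blast
  then obtain r where r: "r > 0"
    and rb: "\<And>u. \<bar>u - t\<bar> < r \<Longrightarrow> \<bar>F1 u - F1 t - (u - t) * c\<bar> \<le> \<rho> / 2 * \<bar>u - t\<bar>"
    by blast
  have "\<bar>F2 (t + s) + F2 (t - s) - 2 * F2 t - c * s\<^sup>2\<bar> \<le> \<rho> * s\<^sup>2" if s: "0 < s" "s < r" for s
  proof -
    define \<psi> where "\<psi> u = F2 (t + u) + F2 (t - u) - 2 * F2 t - c * u\<^sup>2" for u
    have d: "(\<psi> has_real_derivative (F1 (t + u) - F1 (t - u) - 2 * c * u)) (at u)" for u
      unfolding \<psi>_def
      by (auto intro!: derivative_eq_intros DERIV_chain2[OF F2])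
    obtain u where u: "0 < u" "u < s" "\<psi> s - \<psi> 0 = (s - 0) * (F1 (t + u) - F1 (t - u) - 2 * c * u)"
      using MVT2[of 0 s \<psi>, OF s(1) d] by metis
    have "\<bar>F1 (t + u) - F1 t - u * c\<bar> \<le> \<rho> / 2 * u" "\<bar>F1 (t - u) - F1 t - (- u) * c\<bar> \<le> \<rho> / 2 * u"
      using rb[of "t + u"] rb[of "t - u"] u s by auto
    moreover have "F1 (t + u) - F1 (t - u) - 2 * c * u = (F1 (t + u) - F1 t - u * c) - (F1 (t - u) - F1 t - (- u) * c)"
      by simp
    ultimately have "\<bar>F1 (t + u) - F1 (t - u) - 2 * c * u\<bar> \<le> \<rho> / 2 * u + \<rho> / 2 * u"
      by linarith
    then have "\<bar>F1 (t + u) - F1 (t - u) - 2 * c * u\<bar> \<le> \<rho> * u" by simp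
    also have "\<rho> * u \<le> \<rho> * s" using u \<rho> by simp
    finally have "\<bar>\<psi> s\<bar> \<le> s * (\<rho> * s)"
      using u s by (simp add: \<psi>_def abs_mult)
    then show ?thesis by (simp add: \<psi>_def power2_eq_square algebra_simps)
  qed
  then show ?thesis using r by blast
qed

text \<open>Going from radius \<open>k\<close> to \<open>k + 1\<close> adds the one-step second
  differences at the \<open>2 * k + 1\<close> sites within distance \<open>k\<close> of
  \<open>i\<close>, and the odd numbers sum to a square. This lifts the discrete equation from one
  grid step to a fixed time step \<open>s\<close>.\<close>

lemma second_difference_sum:
  fixes x :: "int \<Rightarrow> real"
  assumes "\<And>k. \<bar>k\<bar> < int j \<Longrightarrow> \<bar>x (i + k + 1) - 2 * x (i + k) + x (i + k - 1) - c\<bar> \<le> \<rho>"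
  shows "\<bar>x (i + int j) + x (i - int j) - 2 * x i - c * (real j)\<^sup>2\<bar> \<le> \<rho> * (real j)\<^sup>2"
proof -
  define e where "e k = x (i + int k) + x (i - int k) - 2 * x i" for k
  have inc: "\<bar>e (Suc k) - e k - c * (2 * real k + 1)\<bar> \<le> \<rho> * (2 * real k + 1)" if "k < j" for k
    using that
  proof (induction k)
    case 0
    then show ?case using assms[of 0] by (simp add: e_def algebra_simps)
  next
    case (Suc k)
    have "\<bar>x (i + int (Suc k) + 1) - 2 * x (i + int (Suc k)) + x (i + int (Suc k) - 1) - c\<bar> \<le> \<rho>"
      using assms[of "int (Suc k)"] Suc.prems by simp
    moreover have "\<bar>x (i - int (Suc k) + 1) - 2 * x (i - int (Suc k)) + x (i - int (Suc k) - 1) - c\<bar> \<le> \<rho>"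
      using assms[of "- int (Suc k)"] Suc.prems by (simp add: algebra_simps)
    moreover note Suc.IH
    ultimately show ?case using Suc.prems by (simp add: e_def algebra_simps abs_le_iff)
  qed
  have "\<bar>e k - c * (real k)\<^sup>2\<bar> \<le> \<rho> * (real k)\<^sup>2" if "k \<le> j" for k
    using that
  proof (induction k)
    case 0
    then show ?case by (simp add: e_def)
  next
    case (Suc k)
    then show ?case using inc[of k] by (simp add: power2_eq_square algebra_simps abs_le_iff)
  qed
  from this[of j] show ?thesis by (simp add: e_def)
qed

text \<open>One cell of the discretized Lagrangian action; \<open>b\<close> is already sampled on
  the grid. With the potential taken at the left end point, each site enters exactly one potential
  term and stationarity becomes the three-point scheme.\<close>

definition step_action :: "real \<Rightarrow> (int \<Rightarrow> real) \<Rightarrow> (real \<Rightarrow> real) \<Rightarrow> (int \<Rightarrow> real) \<Rightarrow> int \<Rightarrow> real" where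
  "step_action h b V x k = (x (k + 1) - x k)\<^sup>2 / (2 * h) + h * b k * V (x k)"

text \<open>Paths live on all integers, so the set is a product of compact sets in one function
  space for every \<open>N\<close>, and Tychonoff's theorem applies.\<close>

definition grid_paths :: "int \<Rightarrow> (int \<Rightarrow> real) set" where
  "grid_paths N = {x. (\<forall>i. \<bar>x i\<bar> \<le> 1) \<and> (\<forall>i\<le>-N. x i = -1) \<and> (\<forall>i\<ge>N. x i = 1)}"

lemma compact_PiE_UNIV:
  fixes B :: "'a \<Rightarrow> 'b::topological_space set"
  assumes "\<And>i. compact (B i)"
  shows "compact (PiE UNIV B)"
  using compactin_PiE[of "\<lambda>_. euclidean" UNIV B] assms
  by (simp add: euclidean_product_topology)

lemma compact_grid_paths:
  assumes "N > 0"
  shows "compact (grid_paths N)"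
proof -
  define B :: "int \<Rightarrow> real set" where
    "B i = (if i \<le> -N then {-1} else if i \<ge> N then {1} else {-1..1})" for i
  have "x i \<in> B i \<longleftrightarrow> \<bar>x i\<bar> \<le> 1 \<and> (i \<le> -N \<longrightarrow> x i = -1) \<and> (i \<ge> N \<longrightarrow> x i = 1)" for x i
    using assms by (auto simp: B_def)
  then have "grid_paths N = PiE UNIV B"
    by (auto simp: grid_paths_def PiE_UNIV_domain)
  moreover have "compact (PiE UNIV B)"
    by (rule compact_PiE_UNIV) (simp add: B_def)
  ultimately show ?thesis by simp
qed

lemma grid_minimizer_exists:
  assumes "N > 0" and V: "continuous_on UNIV V"
  obtains x where "x \<in> grid_paths N"
    and "\<And>y. y \<in> grid_paths N \<Longrightarrow>
      (\<Sum>k\<in>{-N..<N}. step_action h b V x k) \<le> (\<Sum>k\<in>{-N..<N}. step_action h b V y k)"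
proof -
  have *: "continuous_on UNIV (\<lambda>x :: int \<Rightarrow> real. x k)" for k
    by (rule continuous_on_product_coordinates)
  have "continuous_on UNIV (\<lambda>x. V (x k))" for k :: int
    using continuous_on_compose2[OF V *] by auto
  then have "continuous_on (grid_paths N) (\<lambda>x. \<Sum>k\<in>{-N..<N}. step_action h b V x k)"
    unfolding step_action_def divide_inverse
    by (intro continuous_intros) (auto intro: continuous_on_subset * )
  moreover have "(\<lambda>i. if i < 0 then -1 else if i \<ge> N then 1 else 0) \<in> grid_paths N"
    using assms by (auto simp: grid_paths_def)
  ultimately show ?thesis
    using continuous_attains_inf[OF compact_grid_paths[OF assms(1)]] that by blast
qed

text \<open>Varying one site gives a function \<open>\<phi>\<close> of one variable with derivative
  \<open>D\<close>. If the site touches 1, minimality on one side yields \<open>D 1 \<le> 0\<close>,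
  while neighbours at most 1 and \<open>W 1 = 0\<close> yield \<open>D 1 \<ge> 0\<close>; at -1 the
  signs are reversed. So the constraint exerts no force.\<close>

lemma grid_minimizer_Euler_Lagrange:
  assumes x: "x \<in> grid_paths N"
    and min: "\<And>y. y \<in> grid_paths N \<Longrightarrow>
      (\<Sum>k\<in>{-N..<N}. step_action h b V x k) \<le> (\<Sum>k\<in>{-N..<N}. step_action h b V y k)"
    and V: "\<And>\<xi>. (V has_real_derivative W \<xi>) (at \<xi>)" and W: "W (-1) = 0" "W 1 = 0"
    and h: "h > 0" and i: "\<bar>i\<bar> < N"
  shows "x (i + 1) - 2 * x i + x (i - 1) = h\<^sup>2 * b i * W (x i)"
proof -
  define l r where "l = x (i - 1)" and "r = x (i + 1)"
  have bnd: "\<bar>x k\<bar> \<le> 1" for k using x by (auto simp: grid_paths_def)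
  define \<phi> where "\<phi> s = (s - l)\<^sup>2 / (2 * h) + (r - s)\<^sup>2 / (2 * h) + h * b i * V s" for s
  have \<phi>min: "\<phi> (x i) \<le> \<phi> s" if s: "\<bar>s\<bar> \<le> 1" for s
  proof -
    have y: "x(i := s) \<in> grid_paths N"
      using x s i by (auto simp: grid_paths_def)
    \<comment> \<open>The value at site \<open>i\<close> occurs only in the cells
      \<open>i - 1\<close> and \<open>i\<close>; all others cancel in the comparison.\<close>
    define R where "R = {-N..<N} - {i - 1, i}"
    have R: "{-N..<N} = insert (i - 1) (insert i R)" "i - 1 \<notin> insert i R" "i \<notin> R" "finite R"
      using i by (auto simp: R_def)
    have split: "(\<Sum>k\<in>{-N..<N}. f k) = f (i - 1) + f i + (\<Sum>k\<in>R. f k)" for f :: "int \<Rightarrow> real"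
      unfolding R(1) using R(2-4) by simp
    have "(\<Sum>k\<in>R. step_action h b V (x(i := s)) k) = (\<Sum>k\<in>R. step_action h b V x k)"
      by (rule sum.cong) (auto simp: R_def step_action_def)
    with min[OF y, unfolded split]
    have "step_action h b V x (i - 1) + step_action h b V x i
       \<le> step_action h b V (x(i := s)) (i - 1) + step_action h b V (x(i := s)) i" by simp
    then show ?thesis
      by (simp add: step_action_def \<phi>_def l_def r_def)
  qed
  define D where "D s = (2 * s - l - r) / h + h * b i * W s" for s
  have D: "(\<phi> has_real_derivative D s) (at s)" for s
    unfolding \<phi>_def D_def using h
    by (auto intro!: derivative_eq_intros V simp: field_simps)
  have "D (x i) = 0"
  proof -
    consider "\<bar>x i\<bar> < 1" | "x i = 1" | "x i = -1" using bnd[of i] by linarith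
    then show ?thesis
    proof cases
      case 1
      show ?thesis
        by (rule DERIV_local_min[OF D, of "1 - \<bar>x i\<bar>"]) (use 1 in \<open>auto intro!: \<phi>min\<close>)
    next
      case 2
      have "D 1 \<ge> 0" using W(2) bnd[of "i - 1"] bnd[of "i + 1"] h by (simp add: D_def l_def r_def)
      moreover have "\<not> D 1 > 0"
      proof
        assume "D 1 > 0"
        then obtain d where d: "d > 0" "\<And>e. 0 < e \<Longrightarrow> e < d \<Longrightarrow> \<phi> (1 - e) < \<phi> 1"
          using DERIV_pos_inc_left[OF D, of 1] by blast
        have "\<phi> 1 \<le> \<phi> (1 - min 1 (d / 2))" using \<phi>min[of "1 - min 1 (d / 2)"] 2 d by auto
        moreover have "0 < min 1 (d / 2)" "min 1 (d / 2) < d" using d(1) by linarith+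
        ultimately show False using d(2) leD by blast
      qed
      ultimately show ?thesis using 2 by simp
    next
      case 3
      have "D (-1) \<le> 0" using W(1) bnd[of "i - 1"] bnd[of "i + 1"] h
        by (simp add: D_def l_def r_def divide_nonpos_pos)
      moreover have "\<not> D (-1) < 0"
      proof
        assume "D (-1) < 0"
        then obtain d where d: "d > 0" "\<And>e. 0 < e \<Longrightarrow> e < d \<Longrightarrow> \<phi> (-1 + e) < \<phi> (-1)"
          using DERIV_neg_dec_right[OF D, of "-1"] by blast
        have "\<phi> (-1) \<le> \<phi> (-1 + min 1 (d / 2))" using \<phi>min[of "-1 + min 1 (d / 2)"] 3 d by auto
        moreover have "0 < min 1 (d / 2)" "min 1 (d / 2) < d" using d(1) by linarith+
        ultimately show False using d(2) leD by blast
      qed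
      ultimately show ?thesis using 3 by simp
    qed
  qed
  then show ?thesis
    using h by (simp add: D_def l_def r_def field_simps power2_eq_square)
qed

text \<open>Each step satisfies \<open>\<bar>\<Delta>x\<bar> sqrt (2 b V(x)) \<le>\<close> action by AM-GM; replacing the left end-point sum
  by an increment of \<open>G\<close> costs \<open>K \<Delta>x\<^sup>2\<close>, which is itself at most \<open>2 h K\<close> times the action.\<close>

lemma segment_action_lower_bound:
  assumes x: "\<And>k. \<bar>x k\<bar> \<le> 1" and h: "h > 0" and m: "m \<ge> 0" and ij: "i \<le> j"
    and b: "\<And>k. i \<le> k \<Longrightarrow> k < j \<Longrightarrow> m \<le> b k"
    and V: "\<And>\<xi>. V \<xi> \<ge> 0"
    and G: "\<And>\<xi> \<eta>. \<bar>\<xi>\<bar> \<le> 1 \<Longrightarrow> \<bar>\<eta>\<bar> \<le> 1 \<Longrightarrow> \<bar>G \<eta> - G \<xi> - (\<eta> - \<xi>) * sqrt (2 * V \<xi>)\<bar> \<le> K * (\<eta> - \<xi>)\<^sup>2"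
    and K: "K \<ge> 0"
  shows "sqrt m * \<bar>G (x j) - G (x i)\<bar> \<le> (1 + 2 * h * K * sqrt m) * (\<Sum>k\<in>{i..<j}. step_action h b V x k)"
  using ij b
proof (induction j rule: int_ge_induct)
  case base
  then show ?case by simp
next
  case (step j)
  define \<Delta> where "\<Delta> = x (j + 1) - x j"
  define A where "A = step_action h b V x j"
  define c where "c = V (x j)"
  have bj: "m \<le> b j" and c: "c \<ge> 0" using step V by (auto simp: c_def)
  have A: "A = \<Delta>\<^sup>2 / (2 * h) + h * b j * c" by (simp add: A_def \<Delta>_def c_def step_action_def)
  have "m * c \<le> b j * c" using bj c by (rule mult_right_mono)
  then have A1: "\<Delta>\<^sup>2 / (2 * h) + h * (m * c) \<le> A" using h by (simp add: A mult.assoc)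
  have A2: "\<Delta>\<^sup>2 \<le> 2 * h * A"
  proof -
    have "0 \<le> h * (m * c)" using h m c by simp
    then have "\<Delta>\<^sup>2 / (2 * h) \<le> A" using A1 by linarith
    then show ?thesis using h by (simp add: field_simps)
  qed
  have "\<bar>\<Delta>\<bar> * sqrt (2 * (m * c)) \<le> A"
  proof -
    have "0 \<le> (\<bar>\<Delta>\<bar> - h * sqrt (2 * (m * c)))\<^sup>2" by simp
    also have "\<dots> = \<Delta>\<^sup>2 - 2 * h * (\<bar>\<Delta>\<bar> * sqrt (2 * (m * c))) + h\<^sup>2 * (2 * (m * c))"
      using m c by (simp add: power2_diff power_mult_distrib algebra_simps)
    moreover have "2 * h * (\<Delta>\<^sup>2 / (2 * h) + h * (m * c)) = \<Delta>\<^sup>2 + h\<^sup>2 * (2 * (m * c))"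
      using h by (simp add: field_simps power2_eq_square)
    ultimately have "2 * h * (\<bar>\<Delta>\<bar> * sqrt (2 * (m * c))) \<le> 2 * h * (\<Delta>\<^sup>2 / (2 * h) + h * (m * c))"
      by linarith
    then have "\<bar>\<Delta>\<bar> * sqrt (2 * (m * c)) \<le> \<Delta>\<^sup>2 / (2 * h) + h * (m * c)"
      using h by simp
    then show ?thesis using A1 by linarith
  qed
  moreover have "sqrt (2 * (m * c)) = sqrt m * sqrt (2 * c)"
    using m c by (simp add: real_sqrt_mult)
  ultimately have A3: "sqrt m * (\<bar>\<Delta>\<bar> * sqrt (2 * c)) \<le> A" by (simp add: ac_simps)
  have "\<bar>G (x (j + 1)) - G (x j)\<bar> \<le> \<bar>\<Delta> * sqrt (2 * c)\<bar> + K * \<Delta>\<^sup>2"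
    using G[OF x x, of "j + 1" j] unfolding \<Delta>_def c_def by linarith
  also have "\<dots> = \<bar>\<Delta>\<bar> * sqrt (2 * c) + K * \<Delta>\<^sup>2" using c by (simp add: abs_mult)
  also have "\<dots> \<le> \<bar>\<Delta>\<bar> * sqrt (2 * c) + K * (2 * h * A)"
    using A2 K by (simp add: mult_left_mono)
  finally have "sqrt m * \<bar>G (x (j + 1)) - G (x j)\<bar> \<le> sqrt m * (\<bar>\<Delta>\<bar> * sqrt (2 * c) + K * (2 * h * A))"
    using m by (intro mult_left_mono) auto
  also have "\<dots> \<le> A + sqrt m * K * (2 * h * A)"
    using A3 by (simp add: algebra_simps)
  finally have "sqrt m * \<bar>G (x (j + 1)) - G (x j)\<bar> \<le> (1 + 2 * h * K * sqrt m) * A"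
    by (simp add: algebra_simps)
  moreover have "sqrt m * \<bar>G (x j) - G (x i)\<bar> \<le> (1 + 2 * h * K * sqrt m) * (\<Sum>k\<in>{i..<j}. step_action h b V x k)"
    using step by simp
  moreover have "sqrt m * \<bar>G (x (j + 1)) - G (x i)\<bar>
      \<le> sqrt m * \<bar>G (x (j + 1)) - G (x j)\<bar> + sqrt m * \<bar>G (x j) - G (x i)\<bar>"
    unfolding distrib_left[symmetric] using m by (intro mult_left_mono) auto
  moreover have "{i..<j + 1} = insert j {i..<j}" using step by auto
  ultimately show ?case by (simp add: A_def algebra_simps)
qed

text \<open>By Tychonoff's theorem a pointwise limit exists along some filter refining \<open>sequentially\<close>;
  this replaces a diagonal subsequence argument.\<close>

lemma bounded_functions_pointwise_cluster:
  fixes Z :: "nat \<Rightarrow> 'a \<Rightarrow> real"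
  assumes "\<And>n t. \<bar>Z n t\<bar> \<le> B"
  obtains x and F :: "nat filter" where "F \<noteq> bot" "F \<le> sequentially"
    "\<And>t. ((\<lambda>n. Z n t) \<longlongrightarrow> x t) F"
proof -
  have "compact (PiE UNIV (\<lambda>_. {-B..B}) :: ('a \<Rightarrow> real) set)"
    by (rule compact_PiE_UNIV) simp
  moreover have "Z n \<in> PiE UNIV (\<lambda>_. {-B..B})" for n
    using assms by (auto simp: PiE_UNIV_domain abs_le_iff minus_le_iff)
  then have "eventually (\<lambda>f. f \<in> PiE UNIV (\<lambda>_. {-B..B})) (filtermap Z sequentially)"
    by (simp add: eventually_filtermap)
  moreover have "filtermap Z sequentially \<noteq> bot"
    by (simp add: filtermap_bot_iff)
  ultimately obtain x where x: "inf (nhds x) (filtermap Z sequentially) \<noteq> bot"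
    unfolding compact_filter by blast
  \<comment> \<open>The cluster point concerns a filter on functions. Pulling its neighbourhoods
    back along \<open>Z\<close> gives a filter on indices, and the meet with
    \<open>sequentially\<close> lets eventual statements be used along it.\<close>
  define F where "F = inf (filtercomap Z (nhds x)) sequentially"
  have "F \<noteq> bot"
  proof
    assume "F = bot"
    then obtain P Q where P: "eventually P (filtercomap Z (nhds x))" and Q: "eventually Q sequentially"
      and PQ: "\<And>n. P n \<and> Q n \<longrightarrow> False"
      unfolding F_def trivial_limit_def eventually_inf by blast
    obtain P' where P': "eventually P' (nhds x)" "\<And>n. P' (Z n) \<Longrightarrow> P n"
      using P unfolding eventually_filtercomap by blast
    have "eventually (\<lambda>f. \<not> P' f) (filtermap Z sequentially)"
      unfolding eventually_filtermap using Q by eventually_elim (use PQ P'(2) in blast)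
    then have "eventually (\<lambda>_. False) (inf (nhds x) (filtermap Z sequentially))"
      unfolding eventually_inf using P'(1) by blast
    with x show False by (simp add: trivial_limit_def)
  qed
  moreover have "F \<le> sequentially" by (simp add: F_def)
  moreover have "((\<lambda>n. Z n t) \<longlongrightarrow> x t) F" for t
  proof -
    have "filterlim Z (nhds x) F"
      unfolding F_def by (rule filterlim_mono[OF filterlim_filtercomap order_refl inf_le1])
    then have Z: "eventually (\<lambda>n. P (Z n)) F" if "eventually P (nhds x)" for P
      using that by (simp add: filterlim_iff)
    show ?thesis
    proof (rule topological_tendstoI)
      fix S :: "real set" assume "open S" "x t \<in> S"
      then have "open ((\<lambda>f :: 'a \<Rightarrow> real. f t) -` S)"
        using continuous_on_product_coordinates by (intro open_vimage)
      then have "eventually (\<lambda>f. f \<in> (\<lambda>f. f t) -` S) (nhds x)"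
        using \<open>x t \<in> S\<close> by (intro eventually_nhds_in_open) auto
      from Z[OF this] show "eventually (\<lambda>n. Z n t \<in> S) F" by simp
    qed
  qed
  ultimately show ?thesis by (rule that)
qed

text \<open>Over \<open>Suc n\<close> steps, that is one unit of time, the increments drift by at
  most \<open>C / real (Suc n)\<close>, while their sum is at most 2 because the path stays in
  [-1,1]. Averaging bounds the first increment, uniformly in the mesh after division by it.\<close>

lemma increment_bound_of_second_difference:
  fixes x :: "int \<Rightarrow> real"
  assumes bnd: "\<And>k. \<bar>x k\<bar> \<le> 1" and C: "C \<ge> 0"
    and D: "\<And>k. i < k \<Longrightarrow> k \<le> i + int (Suc n) \<Longrightarrow>
      \<bar>x (k + 1) - 2 * x k + x (k - 1)\<bar> \<le> (1 / real (Suc n))\<^sup>2 * C"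
  shows "\<bar>x (i + 1) - x i\<bar> \<le> (2 + C) / real (Suc n)"
proof -
  define N where "N = real (Suc n)"
  have N: "N > 0" by (simp add: N_def)
  define d where "d j = x (i + int j + 1) - x (i + int j)" for j
  have step: "\<bar>d j - d 0\<bar> \<le> real j * ((1 / N)\<^sup>2 * C)" if "j \<le> Suc n" for j
    using that
  proof (induction j)
    case (Suc j)
    have "\<bar>d (Suc j) - d j\<bar> \<le> (1 / N)\<^sup>2 * C"
      using D[of "i + int (Suc j)"] Suc.prems by (simp add: d_def N_def algebra_simps)
    moreover have "\<bar>d (Suc j) - d 0\<bar> \<le> \<bar>d (Suc j) - d j\<bar> + \<bar>d j - d 0\<bar>" by linarith
    ultimately show ?case using Suc by (simp add: algebra_simps)
  qed simp
  have "\<bar>d j - d 0\<bar> \<le> C / N" if "j \<le> Suc n" for j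
  proof -
    have "\<bar>d j - d 0\<bar> \<le> real j * ((1 / N)\<^sup>2 * C)" by (rule step[OF that])
    also have "\<dots> \<le> N * ((1 / N)\<^sup>2 * C)" using that C by (intro mult_right_mono) (auto simp: N_def)
    also have "\<dots> = C / N" using N by (simp add: power2_eq_square)
    finally show ?thesis .
  qed
  then have "\<bar>\<Sum>j<Suc n. d j - d 0\<bar> \<le> (\<Sum>j<Suc n. C / N)"
    by (intro order_trans[OF sum_abs] sum_mono) auto
  also have "\<dots> = C" using N by (simp add: N_def)
  finally have "\<bar>(\<Sum>j<Suc n. d j) - N * d 0\<bar> \<le> C" by (simp add: sum_subtractf N_def)
  moreover have tele: "(\<Sum>j<m. d j) = x (i + int m) - x i" for m
    by (induction m) (auto simp: d_def algebra_simps)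
  have "\<bar>\<Sum>j<Suc n. d j\<bar> \<le> 2"
    unfolding tele using bnd[of i] bnd[of "i + int (Suc n)"] by linarith
  ultimately have "\<bar>N * d 0\<bar> \<le> 2 + C" by linarith
  then have "N * \<bar>d 0\<bar> \<le> 2 + C" using N by (simp add: abs_mult)
  then have "\<bar>d 0\<bar> \<le> (2 + C) / N" using N by (subst pos_le_divide_eq) (auto simp: mult.commute)
  then show ?thesis by (simp add: d_def N_def)
qed

lemma increment_bound_sum:
  fixes x :: "int \<Rightarrow> real"
  assumes "i \<le> j" and "\<And>k. i \<le> k \<Longrightarrow> k < j \<Longrightarrow> \<bar>x (k + 1) - x k\<bar> \<le> c"
  shows "\<bar>x j - x i\<bar> \<le> c * real_of_int (j - i)"
  using assms
proof (induction j rule: int_ge_induct)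
  case (step j)
  have "\<bar>x j - x i\<bar> \<le> c * real_of_int (j - i)" using step by auto
  moreover have "\<bar>x (j + 1) - x j\<bar> \<le> c" using step by auto
  ultimately show ?case by (simp add: algebra_simps)
qed simp

text \<open>The equation is available only at times below n+1 in absolute value, so every estimate
  holds for large \<open>n\<close> on a given bounded interval. The last two conclusions carry
  bounds near the wells to the limit; the margin 1 in time leaves room for rounding to the
  grid.\<close>

lemma discrete_solutions_limit:
  fixes X :: "nat \<Rightarrow> int \<Rightarrow> real" and b W :: "real \<Rightarrow> real"
  assumes bnd: "\<And>n i. \<bar>X n i\<bar> \<le> 1"
    and EL: "\<And>n i. \<bar>i\<bar> < (int (Suc n))\<^sup>2 \<Longrightarrow> X n (i + 1) - 2 * X n i + X n (i - 1)
        = (1 / real (Suc n))\<^sup>2 * b (of_int i / real (Suc n)) * W (X n i)"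
    and cb: "continuous_on UNIV b" and bb: "\<And>t. \<bar>b t\<bar> \<le> B"
    and cW: "continuous_on UNIV W"
  obtains x where "\<And>t. \<bar>x t\<bar> \<le> 1" "continuous_on UNIV x"
    and "\<And>t \<rho>. \<rho> > 0 \<Longrightarrow> \<exists>r>0. \<forall>s. 0 < s \<and> s < r \<longrightarrow>
       \<bar>x (t + s) + x (t - s) - 2 * x t - b t * W (x t) * s\<^sup>2\<bar> \<le> \<rho> * s\<^sup>2"
    and "\<And>R c. eventually (\<lambda>n. \<forall>i. of_int i \<ge> R * real (Suc n) \<longrightarrow> c \<le> X n i) sequentially
       \<Longrightarrow> \<forall>t\<ge>R+1. c \<le> x t"
    and "\<And>R c. eventually (\<lambda>n. \<forall>i. of_int i \<le> - R * real (Suc n) \<longrightarrow> X n i \<le> c) sequentially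
       \<Longrightarrow> \<forall>t\<le>-R-1. x t \<le> c"
proof -
  define N where "N n = real (Suc n)" for n
  have N: "N n > 0" for n by (simp add: N_def)
  define Z where "Z n t = X n \<lfloor>t * N n\<rfloor>" for n t
  have Zb: "\<bar>Z n t\<bar> \<le> 1" for n t by (simp add: Z_def bnd)
  obtain x F where F: "F \<noteq> bot" "F \<le> sequentially" and lim: "\<And>t. ((\<lambda>n. Z n t) \<longlongrightarrow> x t) F"
    using bounded_functions_pointwise_cluster[of Z, OF Zb] by metis
  have evF: "eventually P F" if "eventually P sequentially" for P
    using F(2) that by (simp add: le_filter_def)
  have ev_ge: "\<forall>\<^sub>F n in F. N n \<ge> c" for c
  proof (rule evF)
    show "\<forall>\<^sub>F n in sequentially. N n \<ge> c"
      unfolding eventually_sequentially N_def by (rule exI[of _ "nat \<lceil>c\<rceil>"]) linarith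
  qed
  have Ninv: "((\<lambda>n. c / N n) \<longlongrightarrow> 0) F" for c
  proof -
    have "(\<lambda>n. c / N n) \<longlonglongrightarrow> 0"
      unfolding N_def divide_inverse by (rule tendsto_mult_right_zero[OF LIMSEQ_inverse_real_of_nat])
    then show ?thesis using F(2) by (rule tendsto_mono[rotated])
  qed
  have xb: "\<bar>x t\<bar> \<le> 1" for t
    by (rule tendsto_upperbound[OF tendsto_rabs[OF lim] _ F(1)]) (simp add: Zb)
  have "bounded (W ` {-1..1})"
    by (intro compact_imp_bounded compact_continuous_image continuous_on_subset[OF cW]) auto
  then obtain w where w: "\<And>\<xi>. \<bar>\<xi>\<bar> \<le> 1 \<Longrightarrow> \<bar>W \<xi>\<bar> \<le> w"
    unfolding bounded_iff by (metis abs_le_iff atLeastAtMost_iff imageI minus_le_iff real_norm_def)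
  have w0: "w \<ge> 0" using w[of 0] by simp
  have B0: "B \<ge> 0" using bb[of 0] by linarith
  \<comment> \<open>Common Lipschitz constant: the increment bound with \<open>C = B * w\<close>,
    which dominates the right-hand side of the equation.\<close>
  define L where "L = 2 + B * w"
  have L: "L > 0" using B0 w0 by (simp add: L_def add_pos_nonneg)
  have D: "\<bar>X n (k + 1) - 2 * X n k + X n (k - 1)\<bar> \<le> (1 / N n)\<^sup>2 * (B * w)"
    if "\<bar>k\<bar> < (int (Suc n))\<^sup>2" for n k
  proof -
    have "\<bar>b (of_int k / N n) * W (X n k)\<bar> \<le> B * w"
      unfolding abs_mult using bb w[OF bnd] B0 by (intro mult_mono) auto
    then have "(1 / N n)\<^sup>2 * \<bar>b (of_int k / N n) * W (X n k)\<bar> \<le> (1 / N n)\<^sup>2 * (B * w)"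
      by (rule mult_left_mono) simp
    then show ?thesis
      unfolding EL[OF that] N_def by (simp add: abs_mult mult.assoc)
  qed
  \<comment> \<open>The increment bound looks \<open>Suc n\<close> sites ahead, up to
    \<open>(T + 1) * N n\<close>; the condition \<open>T + 2 \<le> N n\<close> keeps these sites
    where the equation holds.\<close>
  have inc: "\<bar>X n (k + 1) - X n k\<bar> \<le> L / N n"
    if k: "\<bar>of_int k\<bar> \<le> T * N n" and T: "T + 2 \<le> N n" for n k T
  proof -
    have kk: "\<bar>j\<bar> < (int (Suc n))\<^sup>2" if "k < j" "j \<le> k + int (Suc n)" for j
    proof -
      have "\<bar>of_int j :: real\<bar> \<le> \<bar>of_int k\<bar> + N n" using that by (simp add: N_def)
      also have "\<dots> \<le> (T + 1) * N n" using k by (simp add: algebra_simps)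
      also have "\<dots> < N n * N n" using T N by (intro mult_strict_right_mono) auto
      finally have "real_of_int \<bar>j\<bar> < real_of_int ((int (Suc n))\<^sup>2)"
        by (simp add: N_def power2_eq_square)
      then show ?thesis by linarith
    qed
    show ?thesis unfolding L_def N_def
      by (rule increment_bound_of_second_difference) (use bnd B0 w0 D kk in \<open>auto simp: N_def\<close>)
  qed
  have Lip: "\<bar>X n j - X n i\<bar> \<le> L / N n * \<bar>of_int j - of_int i\<bar>"
    if "\<bar>of_int i\<bar> \<le> T * N n" "\<bar>of_int j\<bar> \<le> T * N n" "T + 2 \<le> N n" for n i j T
    using that
  proof (induction i j rule: linorder_wlog)
    case (le i j)
    have "\<bar>X n (k + 1) - X n k\<bar> \<le> L / N n" if "i \<le> k" "k < j" for k
    proof (rule inc[OF _ le(4)])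
      have "real_of_int i \<le> of_int k" "real_of_int k \<le> of_int j" using that by auto
      then show "\<bar>real_of_int k\<bar> \<le> T * N n" using le by linarith
    qed
    from increment_bound_sum[of i j "X n" "L / N n", OF le(1) this] le(1) show ?case by simp
  next
    case (sym i j)
    then show ?case by (metis abs_minus_commute)
  qed
  have fl: "\<bar>of_int \<lfloor>t * N n\<rfloor> - t * N n\<bar> \<le> 1" for t n by linarith
  have flT: "\<bar>of_int \<lfloor>t * N n\<rfloor>\<bar> \<le> (\<bar>t\<bar> + 1) * N n" for t n
  proof -
    have "\<bar>of_int \<lfloor>t * N n\<rfloor>\<bar> \<le> \<bar>t * N n\<bar> + 1" by linarith
    also have "\<dots> \<le> \<bar>t\<bar> * N n + N n" using N by (simp add: abs_mult N_def)
    finally show ?thesis by (simp add: algebra_simps)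
  qed
  have xLip: "\<bar>x s - x t\<bar> \<le> L * \<bar>s - t\<bar>" for s t
  proof -
    define T where "T = max \<bar>s\<bar> \<bar>t\<bar> + 1"
    have "\<forall>\<^sub>F n in F. \<bar>Z n s - Z n t\<bar> \<le> L * \<bar>s - t\<bar> + 2 * L / N n"
      using ev_ge[of "T + 2"]
    proof eventually_elim
      case (elim n)
      have T1: "(\<bar>s\<bar> + 1) * N n \<le> T * N n" "(\<bar>t\<bar> + 1) * N n \<le> T * N n"
        using N[of n] by (auto simp: T_def intro!: mult_right_mono)
      have "\<bar>Z n s - Z n t\<bar> \<le> L / N n * \<bar>of_int \<lfloor>s * N n\<rfloor> - of_int \<lfloor>t * N n\<rfloor>\<bar>"
        unfolding Z_def by (rule Lip[of _ T]) (use flT[of s n] flT[of t n] T1 elim in linarith)+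
      also have "\<dots> \<le> L / N n * (\<bar>s * N n - t * N n\<bar> + 2)"
      proof (rule mult_left_mono)
        show "\<bar>of_int \<lfloor>s * N n\<rfloor> - of_int \<lfloor>t * N n\<rfloor>\<bar> \<le> \<bar>s * N n - t * N n\<bar> + 2"
          using fl[of s n] fl[of t n] by linarith
      qed (use L N[of n] in auto)
      also have "\<dots> = L * \<bar>s - t\<bar> + 2 * L / N n"
      proof -
        have "\<bar>s * N n - t * N n\<bar> = \<bar>s - t\<bar> * N n"
          using N[of n] by (simp only: left_diff_distrib[symmetric] abs_mult abs_of_pos)
        then show ?thesis using N[of n] by (simp add: distrib_left)
      qed
      finally show ?case .
    qed
    moreover have "((\<lambda>n. L * \<bar>s - t\<bar> + 2 * L / N n) \<longlongrightarrow> L * \<bar>s - t\<bar> + 0) F"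
      by (intro tendsto_add tendsto_const Ninv)
    moreover have "((\<lambda>n. \<bar>Z n s - Z n t\<bar>) \<longlongrightarrow> \<bar>x s - x t\<bar>) F"
      by (intro tendsto_intros lim)
    ultimately have "\<bar>x s - x t\<bar> \<le> L * \<bar>s - t\<bar> + 0"
      by (rule tendsto_le[OF F(1), rotated 2])
    then show ?thesis by simp
  qed
  have xc: "continuous_on UNIV x"
    by (rule lipschitz_on_continuous_on[of L]) (use xLip L in \<open>auto intro!: lipschitz_onI simp: dist_real_def\<close>)
  have sym: "\<exists>r>0. \<forall>s. 0 < s \<and> s < r \<longrightarrow>
       \<bar>x (t + s) + x (t - s) - 2 * x t - b t * W (x t) * s\<^sup>2\<bar> \<le> \<rho> * s\<^sup>2"
    if \<rho>: "\<rho> > 0" for t \<rho>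
  proof -
    define c where "c = b t * W (x t)"
    have "continuous_on UNIV (\<lambda>p :: real \<times> real. b (fst p) * W (snd p))"
      by (intro continuous_intros continuous_on_compose2[OF cb] continuous_on_compose2[OF cW]) auto
    then have "isCont (\<lambda>p. b (fst p) * W (snd p)) (t, x t)"
      by (simp add: continuous_on_eq_continuous_at)
    then obtain d where d: "d > 0" and dd: "\<And>p. dist p (t, x t) < d \<Longrightarrow> \<bar>b (fst p) * W (snd p) - c\<bar> < \<rho>"
      using \<rho> unfolding continuous_at_eps_delta by (fastforce simp: c_def dist_real_def)
    have dc: "\<bar>b \<tau> * W \<xi> - c\<bar> \<le> \<rho>" if "\<bar>\<tau> - t\<bar> < d / 2" "\<bar>\<xi> - x t\<bar> < d / 2" for \<tau> \<xi>
    proof -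
      have "dist (\<tau>, \<xi>) (t, x t) \<le> \<bar>\<tau> - t\<bar> + \<bar>\<xi> - x t\<bar>"
        unfolding dist_Pair_Pair dist_real_def by (rule sqrt_sum_squares_le_sum_abs[THEN order_trans]) auto
      then show ?thesis using dd[of "(\<tau>, \<xi>)"] that by auto
    qed
    \<comment> \<open>Half of the tolerance \<open>d / 2\<close> goes to moving by \<open>s\<close>
      in time (\<open>s < d / 4\<close>, \<open>L * s < d / 4\<close>), the other half to rounding
      \<open>t\<close> to the grid and to the distance of \<open>Z n t\<close> from
      \<open>x t\<close>.\<close>
    define r where "r = min (d / 4) (d / (4 * L))"
    have r: "r > 0" using d L by (simp add: r_def)
    have "\<bar>x (t + s) + x (t - s) - 2 * x t - c * s\<^sup>2\<bar> \<le> \<rho> * s\<^sup>2" if s: "0 < s" "s < r" for s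
    proof -
      define T where "T = \<bar>t\<bar> + s + 3"
      define i where "i n = \<lfloor>t * N n\<rfloor>" for n
      define j where "j n = nat \<lfloor>s * N n\<rfloor>" for n
      have j: "int (j n) = \<lfloor>s * N n\<rfloor>" for n using s N[of n] by (simp add: j_def)
      have jr: "real (j n) = of_int \<lfloor>s * N n\<rfloor>" for n using j[of n] by (metis of_int_of_nat_eq)
      define Y where "Y n = X n (i n + int (j n)) + X n (i n - int (j n)) - 2 * X n (i n)" for n
      have Ls: "L * s < d / 4"
        using s L by (simp add: r_def field_simps)
      have "\<forall>\<^sub>F n in F. \<bar>Z n t - x t\<bar> < d / 4"
        using tendstoD[OF lim[of t], of "d / 4"] d by (simp add: dist_real_def)
      moreover have "\<forall>\<^sub>F n in F. 1 / N n < d / 4"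
        using order_tendstoD(2)[OF Ninv[of 1], of "d / 4"] d by simp
      moreover note ev_ge[of "T + 2"]
      \<comment> \<open>The first bound is the summed discrete equation at the sites
        \<open>i n - j n\<close>, \<open>i n\<close>, \<open>i n + j n\<close>. The other two
        replace these outer sites by the grid points nearest below \<open>t + s\<close> and
        \<open>t - s\<close>.\<close>
      ultimately have ev: "\<forall>\<^sub>F n in F. \<bar>Y n - (c * (1 / N n)\<^sup>2) * (real (j n))\<^sup>2\<bar> \<le> (\<rho> * (1 / N n)\<^sup>2) * (real (j n))\<^sup>2
          \<and> \<bar>Z n (t + s) - X n (i n + int (j n))\<bar> \<le> 3 * L / N n
          \<and> \<bar>Z n (t - s) - X n (i n - int (j n))\<bar> \<le> 3 * L / N n"
      proof eventually_elim
        case (elim n)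
        have Nn: "N n \<ge> 1" by (simp add: N_def)
        have jle: "real (j n) \<le> s * N n" "real (j n) \<ge> s * N n - 1" unfolding jr by linarith+
        have ib: "\<bar>of_int (i n)\<bar> \<le> (\<bar>t\<bar> + 1) * N n" unfolding i_def by (rule flT)
        have TN: "T * N n = (\<bar>t\<bar> + 1) * N n + s * N n + 2 * N n" by (simp add: T_def algebra_simps)
        have iT: "\<bar>of_int (i n)\<bar> \<le> T * N n" using ib TN Nn s by (smt (verit) mult_pos_pos)
        have range: "\<bar>of_int (i n + k)\<bar> \<le> T * N n" if "\<bar>k\<bar> \<le> int (j n)" for k
        proof -
          have "\<bar>real_of_int k\<bar> \<le> real (j n)" using that by linarith
          then have "\<bar>real_of_int k\<bar> \<le> s * N n" using jle by linarith
          then show ?thesis using ib TN Nn by (simp add: abs_le_iff)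
        qed
        have "\<bar>Y n - (c * (1 / N n)\<^sup>2) * (real (j n))\<^sup>2\<bar> \<le> (\<rho> * (1 / N n)\<^sup>2) * (real (j n))\<^sup>2"
          unfolding Y_def
        proof (rule second_difference_sum)
          fix k :: int assume k: "\<bar>k\<bar> < int (j n)"
          have "\<bar>real_of_int k\<bar> \<le> real (j n)" using k by linarith
          then have ks: "\<bar>real_of_int k\<bar> \<le> s * N n" using jle by linarith
          have "\<bar>of_int (i n + k)\<bar> \<le> T * N n" using k by (intro range) auto
          also have "T * N n < N n * N n" using elim N[of n] by (intro mult_strict_right_mono) auto
          finally have "real_of_int \<bar>i n + k\<bar> < real_of_int ((int (Suc n))\<^sup>2)"
            by (simp add: N_def power2_eq_square)
          then have kN: "\<bar>i n + k\<bar> < (int (Suc n))\<^sup>2" by linarith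
          have "\<bar>of_int (i n + k) / N n - t\<bar> = \<bar>(of_int (i n) - t * N n) + of_int k\<bar> / N n"
            using N[of n] by (simp add: field_simps)
          also have "\<dots> \<le> (1 + s * N n) / N n"
            using N[of n] ks fl[of t n] unfolding i_def by (intro divide_right_mono) linarith+
          also have "\<dots> = 1 / N n + s" using N[of n] by (simp add: field_simps)
          also have "\<dots> < d / 2" using elim s by (simp add: r_def)
          finally have tau: "\<bar>of_int (i n + k) / N n - t\<bar> < d / 2" .
          have "\<bar>X n (i n + k) - X n (i n)\<bar> \<le> L / N n * \<bar>of_int (i n + k) - of_int (i n)\<bar>"
            by (rule Lip[OF iT]) (use range[of k] k elim in auto)
          also have "\<dots> \<le> L / N n * (s * N n)" using ks L N[of n] by (intro mult_left_mono) auto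
          also have "\<dots> = L * s" using N[of n] by simp
          finally have "\<bar>X n (i n + k) - X n (i n)\<bar> < d / 4" using Ls by linarith
          then have xi: "\<bar>X n (i n + k) - x t\<bar> < d / 2" using elim unfolding Z_def i_def by linarith
          have "X n (i n + k + 1) - 2 * X n (i n + k) + X n (i n + k - 1) - c * (1 / N n)\<^sup>2
            = (1 / N n)\<^sup>2 * (b (of_int (i n + k) / N n) * W (X n (i n + k)) - c)"
            unfolding EL[OF kN] N_def by (simp add: algebra_simps)
          then show "\<bar>X n (i n + k + 1) - 2 * X n (i n + k) + X n (i n + k - 1) - c * (1 / N n)\<^sup>2\<bar> \<le> \<rho> * (1 / N n)\<^sup>2"
            using mult_left_mono[OF dc[OF tau xi], of "(1 / N n)\<^sup>2"] by (simp only: abs_mult) (simp add: mult.commute)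
        qed
        moreover have "\<bar>Z n (t + s) - X n (i n + int (j n))\<bar> \<le> 3 * L / N n"
        proof -
          have "\<bar>Z n (t + s) - X n (i n + int (j n))\<bar> \<le> L / N n * \<bar>of_int \<lfloor>(t + s) * N n\<rfloor> - of_int (i n + int (j n))\<bar>"
            unfolding Z_def
          proof (rule Lip[of _ T])
            have "(\<bar>t + s\<bar> + 1) * N n \<le> T * N n" using N[of n] s by (intro mult_right_mono) (auto simp: T_def)
            then show "\<bar>of_int \<lfloor>(t + s) * N n\<rfloor>\<bar> \<le> T * N n" using flT[of "t + s" n] by linarith
          qed (use elim range[of "int (j n)"] in auto)
          also have "\<dots> \<le> L / N n * 3"
          proof (rule mult_left_mono)
            \<comment> \<open>Three roundings occur, each off by at most 1.\<close>
            show "\<bar>real_of_int \<lfloor>(t + s) * N n\<rfloor> - of_int (i n + int (j n))\<bar> \<le> 3"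
              using fl[of "t + s" n] fl[of t n] fl[of s n] distrib_right[of t s "N n"]
              unfolding i_def j of_int_add by linarith
          qed (use L N[of n] in auto)
          finally show ?thesis by (simp add: mult.commute)
        qed
        moreover have "\<bar>Z n (t - s) - X n (i n - int (j n))\<bar> \<le> 3 * L / N n"
        proof -
          have "\<bar>Z n (t - s) - X n (i n - int (j n))\<bar> \<le> L / N n * \<bar>of_int \<lfloor>(t - s) * N n\<rfloor> - of_int (i n - int (j n))\<bar>"
            unfolding Z_def
          proof (rule Lip[of _ T])
            have "(\<bar>t - s\<bar> + 1) * N n \<le> T * N n" using N[of n] s by (intro mult_right_mono) (auto simp: T_def)
            then show "\<bar>of_int \<lfloor>(t - s) * N n\<rfloor>\<bar> \<le> T * N n" using flT[of "t - s" n] by linarith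
          qed (use elim range[of "- int (j n)"] in auto)
          also have "\<dots> \<le> L / N n * 3"
          proof (rule mult_left_mono)
            show "\<bar>real_of_int \<lfloor>(t - s) * N n\<rfloor> - of_int (i n - int (j n))\<bar> \<le> 3"
              using fl[of "t - s" n] fl[of t n] fl[of s n] left_diff_distrib[of t s "N n"]
              unfolding i_def j of_int_diff by linarith
          qed (use L N[of n] in auto)
          finally show ?thesis by (simp add: mult.commute)
        qed
        ultimately show ?case by blast
      qed
      have jl: "((\<lambda>n. real (j n) / N n) \<longlongrightarrow> s) F"
      proof (rule tendsto_sandwich[of "\<lambda>n. s - 1 / N n" _ F "\<lambda>n. s"])
        show "\<forall>\<^sub>F n in F. s - 1 / N n \<le> real (j n) / N n" "\<forall>\<^sub>F n in F. real (j n) / N n \<le> s"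
        proof -
          have "real (j n) \<le> s * N n" "s * N n - 1 \<le> real (j n)" for n unfolding jr by linarith+
          then show "\<forall>\<^sub>F n in F. s - 1 / N n \<le> real (j n) / N n" "\<forall>\<^sub>F n in F. real (j n) / N n \<le> s"
            using N by (auto simp: pos_le_divide_eq pos_divide_le_eq left_diff_distrib intro!: always_eventually)
        qed
        show "((\<lambda>n. s - 1 / N n) \<longlongrightarrow> s) F" using tendsto_diff[OF tendsto_const Ninv[of 1], of s] by simp
      qed simp
      have L3: "((\<lambda>n. 3 * L / N n) \<longlongrightarrow> 0) F" by (rule Ninv)
      have "((\<lambda>n. Z n (t + s) - X n (i n + int (j n))) \<longlongrightarrow> 0) F"
        by (rule Lim_null_comparison[OF _ L3]) (use ev in \<open>auto elim: eventually_mono\<close>)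
      from tendsto_diff[OF lim[of "t + s"] this] have l1: "((\<lambda>n. X n (i n + int (j n))) \<longlongrightarrow> x (t + s)) F" by simp
      have "((\<lambda>n. Z n (t - s) - X n (i n - int (j n))) \<longlongrightarrow> 0) F"
        by (rule Lim_null_comparison[OF _ L3]) (use ev in \<open>auto elim: eventually_mono\<close>)
      from tendsto_diff[OF lim[of "t - s"] this] have l2: "((\<lambda>n. X n (i n - int (j n))) \<longlongrightarrow> x (t - s)) F" by simp
      have l3: "((\<lambda>n. X n (i n)) \<longlongrightarrow> x t) F" using lim[of t] by (simp add: Z_def i_def)
      have "((\<lambda>n. Y n - c * (real (j n) / N n)\<^sup>2) \<longlongrightarrow> x (t + s) + x (t - s) - 2 * x t - c * s\<^sup>2) F"
        unfolding Y_def by (intro tendsto_intros l1 l2 l3 jl)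
      moreover have "((\<lambda>n. \<rho> * (real (j n) / N n)\<^sup>2) \<longlongrightarrow> \<rho> * s\<^sup>2) F"
        by (intro tendsto_intros jl)
      moreover have "\<forall>\<^sub>F n in F. \<bar>Y n - c * (real (j n) / N n)\<^sup>2\<bar> \<le> \<rho> * (real (j n) / N n)\<^sup>2"
        using ev by (auto elim!: eventually_mono simp: power_divide)
      ultimately show ?thesis
        by (intro tendsto_le[OF F(1) _ tendsto_rabs])
    qed
    then show ?thesis using r unfolding c_def by blast
  qed
  have right: "\<forall>t\<ge>R+1. c \<le> x t"
    if ev: "eventually (\<lambda>n. \<forall>i. of_int i \<ge> R * real (Suc n) \<longrightarrow> c \<le> X n i) sequentially" for R c
  proof (intro allI impI)
    fix t assume t: "t \<ge> R + 1"
    have "\<forall>\<^sub>F n in F. c \<le> Z n t"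
      using evF[OF ev]
    proof eventually_elim
      case (elim n)
      have "(R + 1) * N n \<le> t * N n" using t N[of n] by (intro mult_right_mono) auto
      then have "R * N n \<le> t * N n - 1" by (simp add: distrib_right N_def)
      then have "R * N n \<le> of_int \<lfloor>t * N n\<rfloor>" by linarith
      then show ?case using elim by (simp add: Z_def N_def)
    qed
    then show "c \<le> x t" by (rule tendsto_lowerbound[OF lim _ F(1)])
  qed
  have left: "\<forall>t\<le>-R-1. x t \<le> c"
    if ev: "eventually (\<lambda>n. \<forall>i. of_int i \<le> - R * real (Suc n) \<longrightarrow> X n i \<le> c) sequentially" for R c
  proof (intro allI impI)
    fix t assume t: "t \<le> - R - 1"
    have "\<forall>\<^sub>F n in F. Z n t \<le> c"
      using evF[OF ev]
    proof eventually_elim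
      case (elim n)
      have "t * N n \<le> (- R) * N n" using t N[of n] by (intro mult_right_mono) auto
      then have "of_int \<lfloor>t * N n\<rfloor> \<le> - R * N n" by linarith
      then show ?case using elim by (simp add: Z_def N_def)
    qed
    then show "x t \<le> c" by (rule tendsto_upperbound[OF lim _ F(1)])
  qed
  show ?thesis using that xb xc sym right left by blast
qed

lemma sum_int_interval_concat:
  fixes f :: "int \<Rightarrow> real"
  assumes "a \<le> b" "b \<le> c"
  shows "(\<Sum>k\<in>{a..<c}. f k) = (\<Sum>k\<in>{a..<b}. f k) + (\<Sum>k\<in>{b..<c}. f k)"
proof -
  have "{a..<c} = {a..<b} \<union> {b..<c}" using assms by auto
  then show ?thesis by (simp add: sum.union_disjoint)
qed

text \<open>The competitor is the explicit Euler scheme for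
  \<open>z' = \<beta> * sqrt (2 * V z) + \<rho>\<close>. Without \<open>\<rho>\<close> this is the
  equipartition equation, whose solutions take infinite time between the wells; the extra speed
  \<open>\<rho>\<close> makes the path leave -1 and reach 1 by about time \<open>2 / \<rho>\<close>,
  so \<open>b\<close> must be small only there. Kinetic and potential part of a step are each at
  most half of \<open>h\<close> times the squared speed, and the total telescopes.\<close>

lemma competitor_action:
  assumes V: "\<And>\<xi>. V \<xi> \<ge> 0" "V (-1) = 0" "V 1 = 0"
    and G: "\<And>\<xi> \<eta>. \<bar>\<xi>\<bar> \<le> 1 \<Longrightarrow> \<bar>\<eta>\<bar> \<le> 1 \<Longrightarrow> \<bar>G \<eta> - G \<xi> - (\<eta> - \<xi>) * sqrt (2 * V \<xi>)\<bar> \<le> K * (\<eta> - \<xi>)\<^sup>2"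
    and Gmono: "\<And>\<xi> \<eta>. -1 \<le> \<xi> \<Longrightarrow> \<xi> \<le> \<eta> \<Longrightarrow> \<eta> \<le> 1 \<Longrightarrow> G \<xi> \<le> G \<eta>"
    and S: "\<And>\<xi>. \<bar>\<xi>\<bar> \<le> 1 \<Longrightarrow> \<beta> * sqrt (2 * V \<xi>) + \<rho> \<le> M"
    and pos: "h > 0" "K \<ge> 0" "\<beta> \<ge> 0" "\<rho> > 0" "N > 0"
    and Nh: "of_int N * h * \<rho> \<ge> 2"
    and b: "\<And>k. 0 \<le> k \<Longrightarrow> of_int k * h * \<rho> < 2 \<Longrightarrow> b k \<le> \<beta>\<^sup>2"
  shows "\<exists>y\<in>grid_paths N. (\<Sum>k\<in>{-N..<N}. step_action h b V y k)
    \<le> \<beta> * (G 1 - G (-1)) + 2 * \<rho> + h * (2 * (\<beta> * K * M) + M\<^sup>2)"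
proof -
  define g where "g \<xi> = \<beta> * sqrt (2 * V \<xi>) + \<rho>" for \<xi>
  have g: "g \<xi> > 0" for \<xi> using V pos by (simp add: g_def add_nonneg_pos)
  have gM: "g \<xi> \<le> M" if "\<bar>\<xi>\<bar> \<le> 1" for \<xi> using S[OF that] by (simp add: g_def)
  have M: "M > 0" using g[of 0] gM[of 0] by simp
  \<comment> \<open>The cap at 1 lets the path stop in the well instead of overshooting.\<close>
  define z where "z = rec_nat (-1) (\<lambda>_ u. min 1 (u + h * g u))"
  have z0: "z 0 = -1" and zS: "z (Suc j) = min 1 (z j + h * g (z j))" for j
    by (simp_all add: z_def)
  have zb: "-1 \<le> z j \<and> z j \<le> 1" for j
  proof (induction j)
    case (Suc j)
    have "0 < h * g (z j)" using g pos by simp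
    then show ?case using Suc by (simp add: zS)
  qed (simp add: z0)
  have zlow: "min 1 (-1 + real j * h * \<rho>) \<le> z j" for j
  proof (induction j)
    case (Suc j)
    have "h * \<rho> \<le> h * g (z j)" using pos V by (simp add: g_def)
    moreover have "0 < h * \<rho>" using pos by simp
    ultimately show ?case using Suc by (simp add: zS min_def distrib_right split: if_splits)
  qed (simp add: z0)
  define y where "y i = z (nat i)" for i
  have y: "y \<in> grid_paths N"
  proof -
    have "z (nat i) = 1" if i: "i \<ge> N" for i
    proof -
      have "of_int N * h * \<rho> \<le> real (nat i) * h * \<rho>"
        using i pos by (intro mult_right_mono) auto
      then have "1 \<le> z (nat i)" using zlow[of "nat i"] Nh by linarith
      then show ?thesis using zb[of "nat i"] by simp
    qed
    then show ?thesis using zb pos by (auto simp: grid_paths_def y_def z0 abs_le_iff minus_le_iff)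
  qed
  define A where "A j = step_action h b V y (int j)" for j
  define \<kappa> where "\<kappa> = \<rho> + \<beta> * K * M * h"
  have \<kappa>: "\<kappa> > 0" using pos M by (simp add: \<kappa>_def add_pos_nonneg)
  \<comment> \<open>A bound for the action spent on reaching \<open>u\<close>: the ideal cost, a
    rate \<open>\<kappa>\<close> per distance collecting the extra speed and the error of replacing
    \<open>\<Delta> * \<sigma>\<close> by an increment of \<open>G\<close>, and a lump
    \<open>h * M\<^sup>2\<close> for the one step that may be cut short at 1.\<close>
  define E where "E u = \<beta> * (G u - G (-1)) + \<kappa> * (u + 1) + (if u = 1 then h * M\<^sup>2 else 0)" for u
  have AE: "A j \<le> E (z (Suc j)) - E (z j)" for j
  proof (cases "z j = 1")
    case True
    have "z (Suc j) = 1" using True g[of 1] pos by (simp add: zS)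
    then show ?thesis using True V by (simp add: A_def step_action_def y_def nat_add_distrib)
  next
    case False
    then have z1: "z j < 1" using zb[of j] by simp
    define \<Delta> where "\<Delta> = z (Suc j) - z j"
    define \<gamma> where "\<gamma> = g (z j)"
    define \<sigma> where "\<sigma> = sqrt (2 * V (z j))"
    have \<gamma>: "\<gamma> = \<beta> * \<sigma> + \<rho>" "\<gamma> > 0" "\<gamma> \<le> M" using g gM zb[of j] by (auto simp: \<gamma>_def g_def \<sigma>_def)
    have \<sigma>: "\<sigma> \<ge> 0" "V (z j) = \<sigma>\<^sup>2 / 2" using V by (auto simp: \<sigma>_def)
    have \<Delta>: "0 < \<Delta>" "\<Delta> \<le> h * \<gamma>" using z1 \<gamma> pos by (auto simp: \<Delta>_def zS \<gamma>_def[symmetric])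
    \<comment> \<open>A path still below 1 has moved with speed at least \<open>\<rho>\<close>, so
      less than time \<open>2 / \<rho>\<close> has passed.\<close>
    have bj: "b (int j) \<le> \<beta>\<^sup>2" using zlow[of j] z1 by (intro b) auto
    have "\<Delta>\<^sup>2 \<le> (h * \<gamma>)\<^sup>2" using \<Delta> by (intro power_mono) auto
    then have A1: "\<Delta>\<^sup>2 / (2 * h) \<le> h * (\<gamma>\<^sup>2 / 2)"
      using pos by (simp add: field_simps power2_eq_square)
    have "h * b (int j) * V (z j) \<le> h * \<beta>\<^sup>2 * V (z j)"
      using bj V pos by (intro mult_right_mono mult_left_mono) auto
    also have "\<dots> = h * ((\<beta> * \<sigma>)\<^sup>2 / 2)" by (simp add: \<sigma> power_mult_distrib)
    also have "\<dots> \<le> h * (\<gamma>\<^sup>2 / 2)"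
      using pos \<gamma> \<sigma> by (intro mult_left_mono divide_right_mono power_mono) auto
    finally have "A j \<le> h * (\<gamma>\<^sup>2 / 2) + h * (\<gamma>\<^sup>2 / 2)"
      using A1 by (simp add: A_def step_action_def y_def nat_add_distrib \<Delta>_def)
    then have A2: "A j \<le> h * \<gamma>\<^sup>2" by simp
    show ?thesis
    proof (cases "z (Suc j) = 1")
      case True
      have "A j \<le> h * M\<^sup>2"
        using A2 \<gamma> pos by (smt (verit) mult_left_mono power_mono)
      moreover have "\<beta> * (G (z j) - G (-1)) \<le> \<beta> * (G 1 - G (-1))"
        using Gmono[of "z j" 1] zb[of j] pos by (intro mult_left_mono) auto
      moreover have "\<kappa> * (z j + 1) \<le> \<kappa> * 2" using \<kappa> z1 by simp
      ultimately show ?thesis using True False by (simp add: E_def)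
    next
      case False
      then have \<Delta>eq: "\<Delta> = h * \<gamma>" by (auto simp: \<Delta>_def zS \<gamma>_def min_def split: if_splits)
      have "\<Delta> * \<sigma> \<le> G (z (Suc j)) - G (z j) + K * \<Delta>\<^sup>2"
        using G[of "z j" "z (Suc j)"] zb[of j] zb[of "Suc j"] unfolding \<Delta>_def \<sigma>_def by (simp add: abs_le_iff)
      moreover have "\<Delta>\<^sup>2 \<le> \<Delta> * (h * M)"
        unfolding power2_eq_square using \<Delta> \<gamma> pos \<Delta>eq by (intro mult_left_mono) auto
      then have "K * \<Delta>\<^sup>2 \<le> K * (\<Delta> * (h * M))" using pos by (intro mult_left_mono) auto
      ultimately have "\<beta> * (\<Delta> * \<sigma>) \<le> \<beta> * (G (z (Suc j)) - G (z j) + K * (\<Delta> * (h * M)))"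
        using pos by (intro mult_left_mono) auto
      moreover have "h * \<gamma>\<^sup>2 = \<beta> * (\<Delta> * \<sigma>) + \<rho> * \<Delta>"
      proof -
        have "h * \<gamma>\<^sup>2 = \<Delta> * \<gamma>" by (simp add: \<Delta>eq power2_eq_square)
        then show ?thesis by (simp add: \<gamma>(1) algebra_simps)
      qed
      ultimately have "A j \<le> \<beta> * (G (z (Suc j)) - G (z j)) + \<kappa> * \<Delta>"
        using A2 by (simp add: \<kappa>_def algebra_simps)
      then show ?thesis using False \<open>z j \<noteq> 1\<close> by (simp add: E_def \<Delta>_def algebra_simps)
    qed
  qed
  have "(\<Sum>j<n. A j) \<le> E (z n)" for n
  proof (induction n)
    case 0
    then show ?case by (simp add: E_def z0)
  next
    case (Suc n)
    then show ?case using AE[of n] by simp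
  qed
  moreover have "z (nat N) = 1" using y pos unfolding grid_paths_def y_def by blast
  ultimately have "(\<Sum>j<nat N. A j) \<le> E 1" by metis
  moreover have "(\<Sum>k\<in>{-N..<N}. step_action h b V y k) = (\<Sum>j<nat N. A j)"
  proof -
    have "(\<Sum>k\<in>{-N..<0}. step_action h b V y k) = 0"
      by (rule sum.neutral) (auto simp: step_action_def y_def z0 V)
    moreover have "(\<Sum>k\<in>{0..<N}. step_action h b V y k) = (\<Sum>j<nat N. A j)"
      unfolding A_def by (rule sum.reindex_bij_witness[of _ int nat]) auto
    ultimately show ?thesis using sum_int_interval_concat[of "-N" 0 N] pos by simp
  qed
  moreover have "E 1 = \<beta> * (G 1 - G (-1)) + 2 * \<rho> + h * (2 * (\<beta> * K * M) + M\<^sup>2)"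
    by (simp add: E_def \<kappa>_def algebra_simps)
  ultimately show ?thesis by (intro bexI[OF _ y]) simp
qed

text \<open>A path of low action cannot stay away from the wells for long, so it visits a well on each side of
  the region where the coefficient is small. Visiting the wrong well forces a transition where \<open>b \<ge> m2\<close>;
  leaving the right well afterwards forces an additional excursion. Both cost too much.\<close>

lemma low_action_localized:
  assumes x: "x \<in> grid_paths N" and h: "h > 0" and K: "K \<ge> 0"
    and V: "\<And>\<xi>. V \<xi> \<ge> 0"
    and G: "\<And>\<xi> \<eta>. \<bar>\<xi>\<bar> \<le> 1 \<Longrightarrow> \<bar>\<eta>\<bar> \<le> 1 \<Longrightarrow> \<bar>G \<eta> - G \<xi> - (\<eta> - \<xi>) * sqrt (2 * V \<xi>)\<bar> \<le> K * (\<eta> - \<xi>)\<^sup>2"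
    and Gmono: "\<And>\<xi> \<eta>. -1 \<le> \<xi> \<Longrightarrow> \<xi> \<le> \<eta> \<Longrightarrow> \<eta> \<le> 1 \<Longrightarrow> G \<xi> \<le> G \<eta>"
    and m: "0 < m" "m \<le> m2" and b: "\<And>k. m \<le> b k"
    and b2: "\<And>k. R \<le> \<bar>of_int k * h\<bar> \<Longrightarrow> m2 \<le> b k" and R: "R \<ge> 0"
    and U0: "(\<Sum>k\<in>{-N..<N}. step_action h b V x k) \<le> U0"
    and U: "(1 + 2 * h * K * sqrt m2) * U0 < U"
    and \<eta>: "0 < \<eta>" "\<eta> \<le> \<eta>1" "\<eta>1 < 1"
    and v: "\<And>\<xi>. \<bar>\<xi>\<bar> \<le> 1 - \<eta> \<Longrightarrow> v \<le> V \<xi>" and L: "L > h" "U0 < (L - h) * m * v"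
    and T1: "U \<le> sqrt m2 * (G 1 - G (-1 + \<eta>))"
    and T2: "U \<le> sqrt m2 * (G (1 - \<eta>) - G (-1))"
    and T3: "U \<le> sqrt m * ((G (1 - \<eta>) - G (-1)) + (G (1 - \<eta>) - G (1 - \<eta>1)) + (G 1 - G (1 - \<eta>1)))"
    and T4: "U \<le> sqrt m * ((G (-1 + \<eta>1) - G (-1)) + (G (-1 + \<eta>1) - G (-1 + \<eta>)) + (G 1 - G (-1 + \<eta>)))"
  shows "R + L \<le> of_int i * h \<Longrightarrow> 1 - \<eta>1 \<le> x i"
    and "of_int i * h \<le> - (R + L) \<Longrightarrow> x i \<le> -1 + \<eta>1"
proof -
  let ?A = "step_action h b V x"
  have xb: "\<bar>x k\<bar> \<le> 1" for k using x by (simp add: grid_paths_def)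
  have xb': "-1 \<le> x k" "x k \<le> 1" for k using xb[of k] by auto
  have xN: "x (-N) = -1" "x N = 1" using x by (auto simp: grid_paths_def)
  have A0: "?A k \<ge> 0" for k
    using h V b[of k] m by (auto simp: step_action_def intro!: add_nonneg_nonneg mult_nonneg_nonneg)
  have part: "(\<Sum>k\<in>{i..<j}. ?A k) \<le> U0" if "-N \<le> i" "j \<le> N" for i j
  proof -
    have "(\<Sum>k\<in>{i..<j}. ?A k) \<le> (\<Sum>k\<in>{-N..<N}. ?A k)"
      using that A0 by (intro sum_mono2) auto
    then show ?thesis using U0 by simp
  qed
  \<comment> \<open>The discretization factor at the larger level \<open>m2\<close> also dominates
    the one at \<open>m\<close>.\<close>
  define c where "c = 1 + 2 * h * K * sqrt m2"
  have c: "c > 0" using h K m by (simp add: c_def add_pos_nonneg)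
  have Uc: "c * U0 < U" using U by (simp add: c_def)
  have seg: "sqrt \<mu> * \<bar>G (x j) - G (x i)\<bar> \<le> c * (\<Sum>k\<in>{i..<j}. ?A k)"
    if "i \<le> j" "0 \<le> \<mu>" "\<mu> \<le> m2" "\<And>k. i \<le> k \<Longrightarrow> k < j \<Longrightarrow> \<mu> \<le> b k" for i j \<mu>
  proof -
    have "sqrt \<mu> * \<bar>G (x j) - G (x i)\<bar> \<le> (1 + 2 * h * K * sqrt \<mu>) * (\<Sum>k\<in>{i..<j}. ?A k)"
      by (rule segment_action_lower_bound) (use that xb h V G K in auto)
    also have "\<dots> \<le> c * (\<Sum>k\<in>{i..<j}. ?A k)"
      unfolding c_def using that h K A0 by (intro mult_right_mono sum_nonneg add_left_mono mult_left_mono) auto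
    finally show ?thesis .
  qed
  have seg2: "sqrt m2 * \<bar>G (x j) - G (x i)\<bar> < U"
    if ij: "-N \<le> i" "i \<le> j" "j \<le> N" and "\<And>k. i \<le> k \<Longrightarrow> k < j \<Longrightarrow> m2 \<le> b k" for i j
  proof -
    have "sqrt m2 * \<bar>G (x j) - G (x i)\<bar> \<le> c * (\<Sum>k\<in>{i..<j}. ?A k)"
      using that m by (intro seg) auto
    also have "\<dots> \<le> c * U0" using part[OF ij(1,3)] c by simp
    finally show ?thesis using Uc by simp
  qed
  have seg3: "sqrt m * (\<bar>G (x i) - G (-1)\<bar> + \<bar>G (x j) - G (x i)\<bar> + \<bar>G 1 - G (x j)\<bar>) < U"
    if ij: "-N \<le> i" "i \<le> j" "j \<le> N" for i j
  proof -
    have "sqrt m * \<bar>G (x i) - G (-1)\<bar> \<le> c * (\<Sum>k\<in>{-N..<i}. ?A k)"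
      "sqrt m * \<bar>G (x j) - G (x i)\<bar> \<le> c * (\<Sum>k\<in>{i..<j}. ?A k)"
      "sqrt m * \<bar>G 1 - G (x j)\<bar> \<le> c * (\<Sum>k\<in>{j..<N}. ?A k)"
      using seg[of "-N" i m] seg[of i j m] seg[of j N m] ij m b xN by auto
    moreover have "(\<Sum>k\<in>{-N..<N}. ?A k) = (\<Sum>k\<in>{-N..<i}. ?A k) + (\<Sum>k\<in>{i..<j}. ?A k) + (\<Sum>k\<in>{j..<N}. ?A k)"
      using sum_int_interval_concat[of "-N" i N ?A] sum_int_interval_concat[of i j N ?A] ij by simp
    moreover have "c * (\<Sum>k\<in>{-N..<N}. ?A k) \<le> c * U0" using U0 c by simp
    ultimately show ?thesis using Uc by (simp add: distrib_left)
  qed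
  \<comment> \<open>Away from the wells the potential is at least \<open>v\<close>, so a stay of
    length \<open>L - h\<close> alone would cost more than \<open>U0\<close>.\<close>
  have visit: "\<exists>k\<in>{i..<j}. 1 - \<eta> \<le> \<bar>x k\<bar>"
    if ij: "-N \<le> i" "j \<le> N" and Lij: "L - h \<le> of_int (j - i) * h" for i j
  proof (rule ccontr)
    assume neg: "\<not> ?thesis"
    have "0 < of_int (j - i) * h" using Lij L by linarith
    then have "i \<le> j" using h by (simp add: zero_less_mult_iff)
    have v0: "v > 0"
    proof -
      have "0 \<le> U0" using part[of 0 0] x h by (smt (verit) U0 A0 sum_nonneg)
      then have "0 < (L - h) * m * v" using L by linarith
      moreover have "0 < (L - h) * m" using L m by simp
      ultimately show ?thesis by (rule zero_less_mult_pos)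
    qed
    have "h * (m * v) \<le> ?A k" if "k \<in> {i..<j}" for k
    proof -
      have "v \<le> V (x k)" using neg that by (intro v) (metis linear)
      then have "m * v \<le> b k * V (x k)" using b[of k] m v0 by (intro mult_mono) auto
      then have "h * (m * v) \<le> h * b k * V (x k)" using h by simp
      moreover have "0 \<le> (x (k + 1) - x k)\<^sup>2 / (2 * h)" using h by simp
      ultimately show ?thesis unfolding step_action_def by linarith
    qed
    then have "(\<Sum>k\<in>{i..<j}. h * (m * v)) \<le> (\<Sum>k\<in>{i..<j}. ?A k)" by (rule sum_mono)
    also have "\<dots> \<le> U0" by (rule part[OF ij])
    finally have "of_int (j - i) * (h * (m * v)) \<le> U0" using \<open>i \<le> j\<close> by simp
    moreover have "(L - h) * (m * v) \<le> (of_int (j - i) * h) * (m * v)"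
      using Lij m v0 by (intro mult_right_mono) auto
    ultimately show False using L(2) by (simp add: mult.assoc)
  qed
  show "1 - \<eta>1 \<le> x i" if i: "R + L \<le> of_int i * h"
  proof (cases "i < N")
    case False
    then show ?thesis using x \<eta> by (simp add: grid_paths_def)
  next
    case True
    \<comment> \<open>First grid site at time \<open>R\<close> or later; rounding loses at most
      \<open>h\<close>, hence the length \<open>L - h\<close> above.\<close>
    define i0 where "i0 = \<lceil>R / h\<rceil>"
    have i0: "R \<le> of_int i0 * h" "of_int i0 * h \<le> R + h" "i0 \<ge> 0"
    proof -
      have "R / h \<le> of_int i0" "of_int i0 \<le> R / h + 1" unfolding i0_def by linarith+
      then show "R \<le> of_int i0 * h" "of_int i0 * h \<le> R + h" using h by (simp_all add: field_simps)
      show "i0 \<ge> 0" unfolding i0_def using R h by (simp add: le_ceiling_iff) (smt (verit) divide_nonneg_pos)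
    qed
    have "L - h \<le> of_int (i - i0) * h" using i i0 by (simp add: left_diff_distrib)
    moreover have "N \<ge> 0" using True i R L h by (smt (verit) of_int_less_0_iff mult_neg_pos)
    ultimately obtain k where k: "i0 \<le> k" "k < i" "1 - \<eta> \<le> \<bar>x k\<bar>"
      using visit[of i0 i] i0 True by auto
    have kR: "R \<le> of_int j * h" if "k \<le> j" for j
    proof -
      have "of_int i0 * h \<le> of_int j * h" using that k h by (intro mult_right_mono) auto
      then show ?thesis using i0 by linarith
    qed
    have kN: "-N \<le> k" using k i0 \<open>N \<ge> 0\<close> by linarith
    show ?thesis
    proof (cases "x k \<ge> 0")
      case False
      \<comment> \<open>Wrong well: the path is still near -1 at a site beyond \<open>R\<close> and
        must cross to 1 at level \<open>m2\<close>, which \<open>T1\<close> prices.\<close>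
      then have "G (x k) \<le> G (-1 + \<eta>)" using k xb'[of k] \<eta> by (intro Gmono) auto
      then have "sqrt m2 * (G 1 - G (-1 + \<eta>)) \<le> sqrt m2 * \<bar>G (x N) - G (x k)\<bar>"
        unfolding xN using m by (intro mult_left_mono) auto
      also have "\<dots> < U" using kR k kN True by (intro seg2 b2) (auto intro: order_trans[OF _ abs_ge_self])
      finally show ?thesis using T1 by simp
    next
      case xk: True
      show ?thesis
      proof (rule ccontr)
        assume "\<not> 1 - \<eta>1 \<le> x i"
        \<comment> \<open>Right well, then a dip at \<open>i\<close>: the path rises from -1 to near
          1, falls below \<open>1 - \<eta>1\<close> and returns to 1. \<open>T3\<close> prices these
          three legs at level \<open>m\<close>.\<close>
        then have "G (x i) \<le> G (1 - \<eta>1)" using xb'[of i] \<eta> by (intro Gmono) auto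
        moreover have "G (1 - \<eta>) \<le> G (x k)" using k xk xb'[of k] \<eta> by (intro Gmono) auto
        ultimately have "sqrt m * ((G (1 - \<eta>) - G (-1)) + (G (1 - \<eta>) - G (1 - \<eta>1)) + (G 1 - G (1 - \<eta>1)))
          \<le> sqrt m * (\<bar>G (x k) - G (-1)\<bar> + \<bar>G (x i) - G (x k)\<bar> + \<bar>G 1 - G (x i)\<bar>)"
          using m by (intro mult_left_mono) auto
        also have "\<dots> < U" using kN k True by (intro seg3) auto
        finally show False using T3 by simp
      qed
    qed
  qed
  \<comment> \<open>Mirror image in time and space: \<open>T2\<close> excludes a visit near 1 before
    time \<open>-R\<close>, and \<open>T4\<close> an excursion out of -1 at \<open>i\<close> before
    the visit at \<open>k\<close>.\<close>
  show "x i \<le> -1 + \<eta>1" if i: "of_int i * h \<le> - (R + L)"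
  proof (cases "-N < i")
    case False
    then show ?thesis using x \<eta> by (simp add: grid_paths_def)
  next
    case True
    define i0 where "i0 = \<lfloor>- R / h\<rfloor>"
    have i0: "of_int i0 * h \<le> - R" "- R - h \<le> of_int i0 * h" "i0 \<le> 0"
    proof -
      have "of_int i0 \<le> - R / h" "- R / h - 1 \<le> of_int i0" unfolding i0_def by linarith+
      then show 1: "of_int i0 * h \<le> - R" and "- R - h \<le> of_int i0 * h" using h by (simp_all add: field_simps)
      show "i0 \<le> 0" using 1 R h by (smt (verit) of_int_0_less_iff mult_pos_pos)
    qed
    have "L - h \<le> of_int (i0 - i) * h" using i i0 by (simp add: left_diff_distrib)
    moreover have "N \<ge> 0" using True i R L h by (smt (verit) of_int_0_less_iff mult_pos_pos)
    ultimately obtain k where k: "i \<le> k" "k < i0" "1 - \<eta> \<le> \<bar>x k\<bar>"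
      using visit[of i i0] i0 True by auto
    have kR: "of_int j * h \<le> - R" if "j \<le> k" for j
    proof -
      have "of_int j * h \<le> of_int i0 * h" using that k h by (intro mult_right_mono) auto
      then show ?thesis using i0 by linarith
    qed
    have kN: "k \<le> N" using k i0 \<open>N \<ge> 0\<close> by linarith
    show ?thesis
    proof (cases "x k \<ge> 0")
      case xk: True
      then have "G (1 - \<eta>) \<le> G (x k)" using k xb'[of k] \<eta> by (intro Gmono) auto
      then have "sqrt m2 * (G (1 - \<eta>) - G (-1)) \<le> sqrt m2 * \<bar>G (x k) - G (x (-N))\<bar>"
        unfolding xN using m by (intro mult_left_mono) auto
      also have "\<dots> < U"
      proof (intro seg2 b2)
        fix j assume "j < k"
        then show "R \<le> \<bar>of_int j * h\<bar>" using kR[of j] by linarith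
      qed (use True k kN in auto)
      finally show ?thesis using T2 by simp
    next
      case xk: False
      show ?thesis
      proof (rule ccontr)
        assume "\<not> x i \<le> -1 + \<eta>1"
        then have "G (-1 + \<eta>1) \<le> G (x i)" using xb'[of i] \<eta> by (intro Gmono) auto
        moreover have "G (x k) \<le> G (-1 + \<eta>)" using k xk xb'[of k] \<eta> by (intro Gmono) auto
        ultimately have "sqrt m * ((G (-1 + \<eta>1) - G (-1)) + (G (-1 + \<eta>1) - G (-1 + \<eta>)) + (G 1 - G (-1 + \<eta>)))
          \<le> sqrt m * (\<bar>G (x i) - G (-1)\<bar> + \<bar>G (x k) - G (x i)\<bar> + \<bar>G 1 - G (x k)\<bar>)"
          using m by (intro mult_left_mono) auto
        also have "\<dots> < U" using kN k True by (intro seg3) auto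
        finally show False using T4 by simp
      qed
    qed
  qed
qed

text \<open>Subtracting a double antiderivative of \<open>f\<close> leaves a function with vanishing
  symmetric second derivative, hence an affine one. Differentiability of \<open>x\<close> is thus a
  conclusion, obtained from continuity alone.\<close>

lemma symmetric_second_derivative_imp_second_derivative:
  fixes x f :: "real \<Rightarrow> real"
  assumes x: "continuous_on UNIV x" and f: "continuous_on UNIV f"
    and sym: "\<And>t \<rho>. \<rho> > 0 \<Longrightarrow> \<exists>r>0. \<forall>s. 0 < s \<and> s < r \<longrightarrow>
       \<bar>x (t + s) + x (t - s) - 2 * x t - f t * s\<^sup>2\<bar> \<le> \<rho> * s\<^sup>2"
  obtains x' where "\<And>t. (x has_real_derivative x' t) (at t)" "\<And>t. (x' has_real_derivative f t) (at t)"
proof -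
  obtain F1 where F1: "\<And>t. (F1 has_real_derivative f t) (at t)"
    using continuous_antiderivative[OF f] by blast
  have F1c: "continuous_on UNIV F1"
    using F1 DERIV_isCont continuous_at_imp_continuous_on by blast
  obtain F2 where F2: "\<And>t. (F2 has_real_derivative F1 t) (at t)"
    using continuous_antiderivative[OF F1c] by blast
  have F2c: "continuous_on UNIV F2"
    using F2 DERIV_isCont continuous_at_imp_continuous_on by blast
  define y where "y t = x t - F2 t" for t
  have yc: "continuous_on UNIV y" unfolding y_def by (intro continuous_intros x F2c)
  have ysym: "\<exists>r>0. \<forall>s. 0 < s \<and> s < r \<longrightarrow> \<bar>y (t + s) + y (t - s) - 2 * y t\<bar> \<le> \<rho> * s\<^sup>2"
    if \<rho>: "\<rho> > 0" for t \<rho>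
  proof -
    have \<rho>2: "\<rho> / 2 > 0" using \<rho> by simp
    obtain r1 where r1: "r1 > 0" "\<And>s. 0 < s \<Longrightarrow> s < r1 \<Longrightarrow>
        \<bar>x (t + s) + x (t - s) - 2 * x t - f t * s\<^sup>2\<bar> \<le> \<rho> / 2 * s\<^sup>2"
      using sym[OF \<rho>2, of t] by blast
    obtain r2 where r2: "r2 > 0" "\<And>s. 0 < s \<Longrightarrow> s < r2 \<Longrightarrow>
        \<bar>F2 (t + s) + F2 (t - s) - 2 * F2 t - f t * s\<^sup>2\<bar> \<le> \<rho> / 2 * s\<^sup>2"
      using symmetric_second_difference_antiderivative[OF F2 F1 \<rho>2, of t] by blast
    have "\<bar>y (t + s) + y (t - s) - 2 * y t\<bar> \<le> \<rho> * s\<^sup>2" if "0 < s" "s < min r1 r2" for s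
    proof -
      define A where "A = x (t + s) + x (t - s) - 2 * x t - f t * s\<^sup>2"
      define A' where "A' = F2 (t + s) + F2 (t - s) - 2 * F2 t - f t * s\<^sup>2"
      have "\<bar>A\<bar> \<le> \<rho> / 2 * s\<^sup>2" "\<bar>A'\<bar> \<le> \<rho> / 2 * s\<^sup>2"
        using r1(2)[of s] r2(2)[of s] that by (auto simp: A_def A'_def)
      then have "\<bar>A - A'\<bar> \<le> \<rho> / 2 * s\<^sup>2 + \<rho> / 2 * s\<^sup>2" by linarith
      moreover have "y (t + s) + y (t - s) - 2 * y t = A - A'"
        by (simp add: A_def A'_def y_def)
      ultimately show ?thesis by simp
    qed
    moreover have "min r1 r2 > 0" using r1 r2 by simp
    ultimately show ?thesis by blast
  qed
  obtain c d where cd: "\<And>t. y t = c + d * t"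
    using symmetric_second_difference_zero_affine[OF yc ysym] by blast
  then have x_eq: "x = (\<lambda>t. F2 t + (c + d * t))"
    by (auto simp: y_def fun_eq_iff algebra_simps)
  have "(x has_real_derivative F1 t + d) (at t)" for t
    unfolding x_eq by (auto intro!: derivative_eq_intros F2)
  moreover have "((\<lambda>t. F1 t + d) has_real_derivative f t) (at t)" for t
    by (auto intro!: derivative_eq_intros F1)
  ultimately show ?thesis by (rule that)
qed

text \<open>Gronwall for the energy \<open>E\<close>, the squared norm of the pair of
  \<open>w\<close> and \<open>w1\<close>: its derivative is at most \<open>(1 + K) * E\<close> in
  absolute value, so exponential weights propagate \<open>E t0 = 0\<close> in both time
  directions.\<close>

lemma second_order_linear_growth_unique:
  fixes w w1 w2 :: "real \<Rightarrow> real"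
  assumes w: "\<And>t. (w has_real_derivative w1 t) (at t)" "\<And>t. (w1 has_real_derivative w2 t) (at t)"
    and K: "\<And>t. \<bar>w2 t\<bar> \<le> K * \<bar>w t\<bar>" "K \<ge> 0" and 0: "w t0 = 0" "w1 t0 = 0"
  shows "w t = 0"
proof -
  define E where "E t = (w t)\<^sup>2 + (w1 t)\<^sup>2" for t
  define E' where "E' t = 2 * w t * w1 t + 2 * w1 t * w2 t" for t
  have E: "(E has_real_derivative E' t) (at t)" for t
    unfolding E_def E'_def by (auto intro!: derivative_eq_intros w)
  define C where "C = 1 + K"
  have E': "\<bar>E' t\<bar> \<le> C * E t" for t
  proof -
    have "\<bar>w2 t\<bar> * \<bar>w1 t\<bar> \<le> K * \<bar>w t\<bar> * \<bar>w1 t\<bar>" using K by (intro mult_right_mono) auto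
    moreover have "\<bar>E' t\<bar> \<le> 2 * (\<bar>w t\<bar> * \<bar>w1 t\<bar>) + 2 * (\<bar>w2 t\<bar> * \<bar>w1 t\<bar>)"
      unfolding E'_def by (rule order_trans[OF abs_triangle_ineq]) (simp add: abs_mult mult.commute)
    ultimately have "\<bar>E' t\<bar> \<le> C * (2 * (\<bar>w t\<bar> * \<bar>w1 t\<bar>))" by (simp add: C_def algebra_simps)
    also have "2 * (\<bar>w t\<bar> * \<bar>w1 t\<bar>) \<le> E t"
      using sum_squares_bound[of "\<bar>w t\<bar>" "\<bar>w1 t\<bar>"] by (simp add: E_def mult.assoc)
    finally show ?thesis using K by (simp add: C_def mult_left_mono)
  qed
  have E0: "E t0 = 0" using 0 by (simp add: E_def)
  have "E t \<le> 0"
  proof (cases "t0 \<le> t")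
    case True
    have "E t * exp (- C * t) \<le> E t0 * exp (- C * t0)"
    proof (rule DERIV_nonpos_imp_nonincreasing[OF True])
      fix s
      have "((\<lambda>s. E s * exp (- C * s)) has_real_derivative (E' s - C * E s) * exp (- C * s)) (at s)"
        by (auto intro!: derivative_eq_intros E simp: algebra_simps)
      moreover have "(E' s - C * E s) * exp (- C * s) \<le> 0"
        using E'[of s] by (intro mult_nonpos_nonneg) auto
      ultimately show "\<exists>y. ((\<lambda>s. E s * exp (- C * s)) has_real_derivative y) (at s) \<and> y \<le> 0" by blast
    qed
    then show ?thesis using E0 by (simp add: mult_le_0_iff)
  next
    case False
    then have "t \<le> t0" by simp
    have "E t * exp (C * t) \<le> E t0 * exp (C * t0)"
    proof (rule DERIV_nonneg_imp_nondecreasing[OF \<open>t \<le> t0\<close>])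
      fix s
      have "((\<lambda>s. E s * exp (C * s)) has_real_derivative (E' s + C * E s) * exp (C * s)) (at s)"
        by (auto intro!: derivative_eq_intros E simp: algebra_simps)
      moreover have "(E' s + C * E s) * exp (C * s) \<ge> 0"
        using E'[of s] by (intro mult_nonneg_nonneg) auto
      ultimately show "\<exists>y. ((\<lambda>s. E s * exp (C * s)) has_real_derivative y) (at s) \<and> y \<ge> 0" by blast
    qed
    then show ?thesis using E0 by (simp add: mult_le_0_iff)
  qed
  then show ?thesis by (simp add: E_def sum_power2_le_zero_iff)
qed

text \<open>After time \<open>R\<close> the slope is nondecreasing. A positive slope would push
  \<open>y\<close> above \<open>c\<close>, so \<open>y\<close> decreases; were it to stay above some
  \<open>e > 0\<close>, the slope would grow at rate at least \<open>\<kappa> * e\<close> and become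
  positive.\<close>

lemma bounded_strongly_convex_tendsto_zero:
  fixes y y1 y2 :: "real \<Rightarrow> real"
  assumes y: "\<And>t. (y has_real_derivative y1 t) (at t)" "\<And>t. (y1 has_real_derivative y2 t) (at t)"
    and bnd: "\<And>t. 0 \<le> y t" "\<And>t. y t \<le> c"
    and \<kappa>: "\<kappa> > 0" "\<And>t. t \<ge> R \<Longrightarrow> \<kappa> * y t \<le> y2 t"
  shows "(y \<longlongrightarrow> 0) at_top"
proof -
  have y1mono: "y1 s \<le> y1 t" if "R \<le> s" "s \<le> t" for s t
  proof (rule DERIV_nonneg_imp_nondecreasing[OF that(2)])
    fix u assume "s \<le> u"
    then have "0 \<le> \<kappa> * y u" "\<kappa> * y u \<le> y2 u" using bnd \<kappa> that by auto
    then have "0 \<le> y2 u" by linarith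
    then show "\<exists>z. (y1 has_real_derivative z) (at u) \<and> 0 \<le> z" using y(2) by blast
  qed
  have y1: "y1 t \<le> 0" if "R \<le> t" for t
  proof (rule ccontr)
    assume "\<not> y1 t \<le> 0"
    then have pos: "y1 t > 0" by simp
    \<comment> \<open>At this time the slope has forced a rise of at least
      \<open>c + 1\<close>.\<close>
    define u where "u = t + (c + 1) / y1 t"
    have "c \<ge> 0" using bnd[of 0] by linarith
    then have u: "t < u" using pos by (simp add: u_def)
    obtain z where z: "t < z" "z < u" "y u - y t = (u - t) * y1 z"
      using MVT2[OF u y(1)] by metis
    have "(u - t) * y1 t \<le> (u - t) * y1 z" using y1mono[of t z] z u that by (intro mult_left_mono) auto
    then have "c + 1 \<le> y u - y t" using z pos by (simp add: u_def)
    then show False using bnd(1)[of t] bnd(2)[of u] by linarith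
  qed
  have ymono: "y t \<le> y s" if "R \<le> s" "s \<le> t" for s t
    by (rule DERIV_nonpos_imp_nonincreasing[OF that(2)]) (use y(1) y1 that in \<open>meson order_trans\<close>)
  have small: "\<exists>t\<ge>R. y t < e" if e: "e > 0" for e
  proof (rule ccontr)
    assume neg: "\<not> ?thesis"
    \<comment> \<open>Long enough for the slope to climb from \<open>y1 R\<close> to at least
      1.\<close>
    define u where "u = R + (1 - y1 R) / (\<kappa> * e)"
    have u: "R < u" using y1[of R] e \<kappa> by (simp add: u_def)
    obtain z where z: "R < z" "z < u" "y1 u - y1 R = (u - R) * y2 z"
      using MVT2[OF u y(2)] by metis
    have "e \<le> y z" using neg z by (meson less_imp_le not_less)
    then have "\<kappa> * e \<le> \<kappa> * y z" using \<kappa> by simp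
    also have "\<dots> \<le> y2 z" using \<kappa> z by auto
    finally have "(u - R) * (\<kappa> * e) \<le> (u - R) * y2 z" using u by (intro mult_left_mono) auto
    moreover have "(u - R) * (\<kappa> * e) = 1 - y1 R" using e \<kappa> by (simp add: u_def)
    ultimately have "1 \<le> y1 u" using z by linarith
    then show False using y1[of u] u by simp
  qed
  show ?thesis
  proof (rule tendstoI)
    fix e :: real assume "e > 0"
    then obtain t where t: "t \<ge> R" "y t < e" using small by blast
    show "\<forall>\<^sub>F s in at_top. dist (y s) 0 < e"
      using eventually_ge_at_top[of t]
    proof eventually_elim
      case (elim s)
      then show ?case using ymono[OF t(1), of s] t bnd(1)[of s] by simp
    qed
  qed
qed

text \<open>An error of half the slope keeps \<open>W \<xi>\<close> between \<open>l / 2\<close> and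
  \<open>3 * l / 2\<close> times \<open>\<xi> - p\<close>, which fixes its sign and gives linear
  growth away from the zero.\<close>

lemma sign_near_nondegenerate_zero:
  fixes W :: "real \<Rightarrow> real"
  assumes "(W has_real_derivative l) (at p)" "W p = 0" "l > 0"
  obtains d where "d > 0" "\<And>\<xi>. \<bar>\<xi> - p\<bar> < d \<Longrightarrow> \<bar>W \<xi> - (\<xi> - p) * l\<bar> \<le> l / 2 * \<bar>\<xi> - p\<bar>"
proof -
  have "(W has_derivative (\<lambda>x. x * l)) (at p)"
    by (rule has_derivative_eq_rhs[OF assms(1)[unfolded has_field_derivative_def]]) (simp add: fun_eq_iff)
  then have "\<exists>d>0. \<forall>\<xi>. \<bar>\<xi> - p\<bar> < d \<longrightarrow> \<bar>W \<xi> - W p - (\<xi> - p) * l\<bar> \<le> l / 2 * \<bar>\<xi> - p\<bar>"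
    unfolding has_derivative_within_alt real_norm_def using half_gt_zero[OF assms(3)] by blast
  then show ?thesis using that assms(2) by auto
qed

text \<open>For nonnegative \<open>V\<close> one has \<open>V'\<^sup>2 \<le> 2 C V\<close>: evaluate the Taylor bound at \<open>\<xi> - V' \<xi> / C\<close>.\<close>

lemma sqrt_nonneg_C2_lipschitz:
  fixes V W W2 :: "real \<Rightarrow> real"
  assumes V: "\<And>\<xi>. (V has_real_derivative W \<xi>) (at \<xi>)" and W: "\<And>\<xi>. (W has_real_derivative W2 \<xi>) (at \<xi>)"
    and C: "\<And>\<xi>. \<bar>\<xi>\<bar> \<le> 2 \<Longrightarrow> \<bar>W \<xi>\<bar> \<le> C" "\<And>\<xi>. \<bar>\<xi>\<bar> \<le> 2 \<Longrightarrow> \<bar>W2 \<xi>\<bar> \<le> C" "C > 0"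
    and nonneg: "\<And>\<xi>. V \<xi> \<ge> 0" and pos: "\<And>\<xi>. -1 < \<xi> \<Longrightarrow> \<xi> < 1 \<Longrightarrow> V \<xi> > 0"
    and \<xi>: "\<bar>\<xi>\<bar> \<le> 1" and \<eta>: "\<bar>\<eta>\<bar> \<le> 1"
  shows "\<bar>sqrt (2 * V \<eta>) - sqrt (2 * V \<xi>)\<bar> \<le> sqrt C * \<bar>\<eta> - \<xi>\<bar>"
proof -
  have W_sq: "(W \<zeta>)\<^sup>2 \<le> 2 * C * V \<zeta>" if \<zeta>: "\<bar>\<zeta>\<bar> \<le> 1" for \<zeta>
  proof (cases "W \<zeta> = 0")
    case True
    then show ?thesis using C nonneg by simp
  next
    case False
    define y where "y = \<zeta> - W \<zeta> / C"
    \<comment> \<open>The test point leaves [-1,1] by at most 1, which is why \<open>W\<close> and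
      \<open>W2\<close> are bounded on [-2,2].\<close>
    have "\<bar>W \<zeta> / C\<bar> \<le> 1" using C(1)[of \<zeta>] C(3) \<zeta> by simp
    then have y: "\<bar>y\<bar> \<le> 2" using \<zeta> unfolding y_def by linarith
    define D where "D m = (if m = 0 then V else if m = (1::nat) then W else W2)" for m
    have "\<exists>t. (if y < \<zeta> then y < t \<and> t < \<zeta> else \<zeta> < t \<and> t < y) \<and>
        V y = (\<Sum>m<2. D m \<zeta> / fact m * (y - \<zeta>) ^ m) + D 2 t / fact 2 * (y - \<zeta>) ^ 2"
    proof (rule Taylor[of 2 D V "-2" 2])
      show "\<forall>m t. m < 2 \<and> - 2 \<le> t \<and> t \<le> 2 \<longrightarrow> DERIV (D m) t :> D (Suc m) t"
        using V W by (auto simp: D_def less_2_cases_iff)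
    qed (use y \<zeta> False C in \<open>auto simp: D_def y_def\<close>)
    then obtain t where t: "if y < \<zeta> then y < t \<and> t < \<zeta> else \<zeta> < t \<and> t < y"
      "V y = V \<zeta> + W \<zeta> * (y - \<zeta>) + W2 t / 2 * (y - \<zeta>)\<^sup>2"
      by (auto simp: D_def numeral_2_eq_2)
    have "\<bar>W2 t\<bar> \<le> C" using t(1) y \<zeta> by (intro C) (auto split: if_splits)
    then have "W2 t / 2 * (y - \<zeta>)\<^sup>2 \<le> C / 2 * (y - \<zeta>)\<^sup>2" by (intro mult_right_mono) auto
    then have "0 \<le> V \<zeta> + W \<zeta> * (y - \<zeta>) + C / 2 * (y - \<zeta>)\<^sup>2" using t(2) nonneg[of y] by linarith
    also have "\<dots> = V \<zeta> - (W \<zeta>)\<^sup>2 / (2 * C)"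
      using C(3) by (simp add: y_def power2_eq_square field_simps)
    finally show ?thesis using C(3) by (simp add: field_simps)
  qed
  have sc: "continuous_on S (\<lambda>\<xi>. sqrt (2 * V \<xi>))" for S
    using V by (intro continuous_intros) (meson DERIV_isCont continuous_at_imp_continuous_on)
  have main: "\<bar>sqrt (2 * V \<eta>) - sqrt (2 * V \<xi>)\<bar> \<le> sqrt C * \<bar>\<eta> - \<xi>\<bar>"
    if "\<xi> < \<eta>" "-1 \<le> \<xi>" "\<eta> \<le> 1" for \<xi> \<eta>
  proof -
    \<comment> \<open>The square root may fail to be differentiable at the wells, but the mean value
      theorem asks only for interior points, where \<open>V\<close> is positive and
      \<open>W_sq\<close> bounds the squared slope by \<open>C\<close>.\<close>
    have d: "((\<lambda>\<xi>. sqrt (2 * V \<xi>)) has_real_derivative W z / sqrt (2 * V z)) (at z)" if "-1 < z" "z < 1" for z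
      using pos[OF that] by (auto intro!: derivative_eq_intros V simp: field_simps)
    have diff: "(\<lambda>\<xi>. sqrt (2 * V \<xi>)) differentiable (at z)" if "\<xi> < z" "z < \<eta>" for z
      using d[of z] that \<open>-1 \<le> \<xi>\<close> \<open>\<eta> \<le> 1\<close> by (auto simp: real_differentiable_def)
    obtain l z where z: "\<xi> < z" "z < \<eta>" "((\<lambda>\<xi>. sqrt (2 * V \<xi>)) has_real_derivative l) (at z)"
      "sqrt (2 * V \<eta>) - sqrt (2 * V \<xi>) = (\<eta> - \<xi>) * l"
      using MVT[OF \<open>\<xi> < \<eta>\<close> sc diff] by metis
    have z1: "-1 < z" "z < 1" using z that by auto
    then have l: "l = W z / sqrt (2 * V z)" using d z(3) DERIV_unique by blast
    have "l\<^sup>2 = (W z)\<^sup>2 / (2 * V z)" using pos[OF z1] by (simp add: l power_divide)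
    also have "\<dots> \<le> C" using W_sq[of z] z1 pos[OF z1] by (simp add: divide_le_eq mult.commute mult.left_commute)
    finally have "\<bar>l\<bar> \<le> sqrt C" by (metis real_sqrt_abs real_sqrt_le_iff)
    then have "\<bar>\<eta> - \<xi>\<bar> * \<bar>l\<bar> \<le> \<bar>\<eta> - \<xi>\<bar> * sqrt C" by (intro mult_left_mono) auto
    then show ?thesis unfolding z(4) by (simp add: abs_mult mult.commute)
  qed
  consider "\<xi> < \<eta>" | "\<xi> = \<eta>" | "\<eta> < \<xi>" by linarith
  then show ?thesis
  proof cases
    case 1 then show ?thesis using main[of \<xi> \<eta>] \<xi> \<eta> by auto
  next
    case 3 then show ?thesis using main[of \<eta> \<xi>] \<xi> \<eta> by (simp add: abs_minus_commute)
  qed simp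
qed

text \<open>The mean value theorem turns the increment into \<open>s z\<close> at an intermediate
  \<open>z\<close>, and the Lipschitz bound replaces \<open>z\<close> by \<open>\<xi>\<close>. For
  \<open>s = sqrt (2 * V)\<close> this is the quadrature error allowed for in the action
  estimates.\<close>

lemma antiderivative_increment_error:
  fixes G s :: "real \<Rightarrow> real"
  assumes G: "\<And>\<xi>. (G has_real_derivative s \<xi>) (at \<xi>)"
    and s: "\<And>\<xi> \<eta>. \<bar>\<xi>\<bar> \<le> 1 \<Longrightarrow> \<bar>\<eta>\<bar> \<le> 1 \<Longrightarrow> \<bar>s \<eta> - s \<xi>\<bar> \<le> K * \<bar>\<eta> - \<xi>\<bar>" and K: "K \<ge> 0"
    and \<xi>: "\<bar>\<xi>\<bar> \<le> 1" "\<bar>\<eta>\<bar> \<le> 1"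
  shows "\<bar>G \<eta> - G \<xi> - (\<eta> - \<xi>) * s \<xi>\<bar> \<le> K * (\<eta> - \<xi>)\<^sup>2"
proof -
  obtain z where z: "\<bar>z\<bar> \<le> 1" "\<bar>z - \<xi>\<bar> \<le> \<bar>\<eta> - \<xi>\<bar>" "G \<eta> - G \<xi> = (\<eta> - \<xi>) * s z"
  proof -
    consider "\<xi> < \<eta>" | "\<xi> = \<eta>" | "\<eta> < \<xi>" by linarith
    then show ?thesis
    proof cases
      case 1
      obtain z where "\<xi> < z" "z < \<eta>" "G \<eta> - G \<xi> = (\<eta> - \<xi>) * s z" using MVT2[OF 1 G] by metis
      then show ?thesis using \<xi> by (intro that[of z]) auto
    next
      case 2
      then show ?thesis using \<xi> by (intro that[of \<xi>]) auto
    next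
      case 3
      obtain z where "\<eta> < z" "z < \<xi>" "G \<xi> - G \<eta> = (\<xi> - \<eta>) * s z" using MVT2[OF 3 G] by metis
      then show ?thesis using \<xi> by (intro that[of z]) (auto simp: algebra_simps)
    qed
  qed
  have "\<bar>s z - s \<xi>\<bar> \<le> K * \<bar>\<eta> - \<xi>\<bar>"
    using s[OF \<xi>(1) z(1)] mult_left_mono[OF z(2) K] by linarith
  then have "\<bar>\<eta> - \<xi>\<bar> * \<bar>s z - s \<xi>\<bar> \<le> \<bar>\<eta> - \<xi>\<bar> * (K * \<bar>\<eta> - \<xi>\<bar>)" by (intro mult_left_mono) auto
  then show ?thesis unfolding z(3) right_diff_distrib[symmetric]
    by (simp add: abs_mult power2_eq_square mult.left_commute)
qed

theorem theorem3p1: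
  fixes V a :: "real \<Rightarrow> real"
  assumes V_C2: "C2 V"
    and V_nonneg: "\<forall>x. V x \<ge> 0"
    and V_wells: "V (-1) = 0" "V 1 = 0"
    and V_pos: "\<forall>x. -1 < x \<and> x < 1 \<longrightarrow> V x > 0"
    and V_nondeg: "deriv (deriv V) (-1) > 0" "deriv (deriv V) 1 > 0"
    and a_bdd: "bounded (range a)"
    and a_cont: "continuous_on UNIV a"
    and a_inf: "(INF t. a t) = a 0"
    and a_pos: "a 0 > 0"
    and a_liminf: "Liminf at_infinity (\<lambda>t. ereal (a t)) > ereal (INF t. a t)"
  shows "\<exists>\<epsilon>s>0. \<forall>\<epsilon>. 0 < \<epsilon> \<and> \<epsilon> < \<epsilon>s \<longrightarrow>
           (\<exists>x :: real \<Rightarrow> real. C2 x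
              \<and> (\<forall>t. deriv (deriv x) t = a (\<epsilon> * t) * deriv V (x t))
              \<and> (x \<longlongrightarrow> -1) at_bot \<and> (x \<longlongrightarrow> 1) at_top
              \<and> (\<forall>t. -1 < x t \<and> x t < 1))"
proof -

  \<comment> \<open>The potential, its derivatives and the weighted distance \<open>G\<close>
    between the wells\<close>
  define W where "W = deriv V"
  define W2 where "W2 = deriv W"
  have dV: "(V has_real_derivative W \<xi>) (at \<xi>)" and dW: "(W has_real_derivative W2 \<xi>) (at \<xi>)" for \<xi>
    using V_C2 unfolding C2_def W_def W2_def by (auto simp: DERIV_deriv_iff_real_differentiable)
  have cW2: "continuous_on UNIV W2" using V_C2 by (simp add: C2_def W2_def W_def)
  have cW: "continuous_on UNIV W" using dW DERIV_isCont continuous_at_imp_continuous_on by blast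
  have cV: "continuous_on UNIV V" using dV DERIV_isCont continuous_at_imp_continuous_on by blast
  have V0: "V \<xi> \<ge> 0" for \<xi> using V_nonneg by simp
  have W_wells: "W (-1) = 0" "W 1 = 0"
    using DERIV_local_min[OF dV, of 1 "-1"] DERIV_local_min[OF dV, of 1 1] V0 V_wells by auto
  obtain C where C: "\<And>\<xi>. \<bar>\<xi>\<bar> \<le> 2 \<Longrightarrow> \<bar>W \<xi>\<bar> \<le> C" "\<And>\<xi>. \<bar>\<xi>\<bar> \<le> 2 \<Longrightarrow> \<bar>W2 \<xi>\<bar> \<le> C" "C > 0"
  proof -
    have bd: "\<exists>c. \<forall>\<xi>\<in>{-2..2}. \<bar>f \<xi>\<bar> \<le> c" if "continuous_on UNIV f" for f :: "real \<Rightarrow> real"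
    proof -
      have "bounded (f ` {-2..2})"
        by (intro compact_imp_bounded compact_continuous_image continuous_on_subset[OF that]) auto
      then show ?thesis by (simp add: bounded_iff)
    qed
    obtain c1 c2 where "\<forall>\<xi>\<in>{-2..2}. \<bar>W \<xi>\<bar> \<le> c1" "\<forall>\<xi>\<in>{-2..2}. \<bar>W2 \<xi>\<bar> \<le> c2"
      using bd[OF cW] bd[OF cW2] by blast
    then show ?thesis by (intro that[of "max 1 (max c1 c2)"]) (force simp: le_max_iff_disj)+
  qed
  define s where "s \<xi> = sqrt (2 * V \<xi>)" for \<xi>
  have sLip: "\<bar>s \<eta> - s \<xi>\<bar> \<le> sqrt C * \<bar>\<eta> - \<xi>\<bar>" if "\<bar>\<xi>\<bar> \<le> 1" "\<bar>\<eta>\<bar> \<le> 1" for \<xi> \<eta>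
    unfolding s_def by (rule sqrt_nonneg_C2_lipschitz[OF dV dW C]) (use V0 V_pos that in auto)
  have sc: "continuous_on UNIV s" unfolding s_def by (intro continuous_intros cV)
  obtain G where dG: "\<And>\<xi>. (G has_real_derivative s \<xi>) (at \<xi>)"
    using continuous_antiderivative[OF sc] by blast
  define K where "K = sqrt C"
  have K: "K \<ge> 0" using C by (simp add: K_def)
  have G: "\<bar>G \<eta> - G \<xi> - (\<eta> - \<xi>) * sqrt (2 * V \<xi>)\<bar> \<le> K * (\<eta> - \<xi>)\<^sup>2" if "\<bar>\<xi>\<bar> \<le> 1" "\<bar>\<eta>\<bar> \<le> 1" for \<xi> \<eta>
    unfolding s_def[symmetric] K_def by (rule antiderivative_increment_error[OF dG sLip]) (use C that in auto)
  have Gmono: "G \<xi> \<le> G \<eta>" if "\<xi> \<le> \<eta>" for \<xi> \<eta>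
  proof (rule DERIV_nonneg_imp_nondecreasing[OF that])
    show "\<exists>z. (G has_real_derivative z) (at u) \<and> 0 \<le> z" for u
      using dG[of u] V0[of u] by (intro exI[of _ "s u"]) (simp add: s_def)
  qed
  have Gstrict: "G \<xi> < G \<eta>" if lt: "-1 \<le> \<xi>" "\<xi> < \<eta>" "\<eta> \<le> 1" for \<xi> \<eta>
  proof -
    obtain z where z: "\<xi> < z" "z < \<eta>" "G \<eta> - G \<xi> = (\<eta> - \<xi>) * s z"
      using MVT2[OF lt(2) dG] by metis
    have "s z > 0" using V_pos z lt by (simp add: s_def)
    then have "(\<eta> - \<xi>) * s z > 0" using lt by simp
    then show ?thesis using z by simp
  qed
  obtain S where S: "\<And>\<xi>. \<bar>\<xi>\<bar> \<le> 1 \<Longrightarrow> s \<xi> \<le> S"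
  proof -
    have "bounded (s ` {-1..1})"
      by (intro compact_imp_bounded compact_continuous_image continuous_on_subset[OF sc]) auto
    then obtain B where "\<forall>\<xi>\<in>{-1..1}. \<bar>s \<xi>\<bar> \<le> B" by (auto simp: bounded_iff)
    then show ?thesis by (intro that[of B]) (force simp: abs_le_iff)
  qed

  \<comment> \<open>Levels of the coefficient\<close>
  define m where "m = a 0"
  have m: "m > 0" using a_pos by (simp add: m_def)
  have am: "m \<le> a t" for t
    unfolding m_def a_inf[symmetric] by (rule cINF_lower) (use a_bdd in \<open>auto intro: bounded_imp_bdd_below\<close>)
  obtain B where B: "\<And>t. \<bar>a t\<bar> \<le> B" using a_bdd by (auto simp: bounded_iff)
  obtain m2 R where m2: "m < m2" and R: "R \<ge> 0" and a2: "\<And>t. R \<le> \<bar>t\<bar> \<Longrightarrow> m2 \<le> a t"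
  proof -
    obtain q where q: "ereal m < q" "q < Liminf at_infinity (\<lambda>t. ereal (a t))"
      using dense[OF a_liminf] by (auto simp: a_inf m_def)
    have "eventually (\<lambda>t. q < ereal (a t)) at_infinity" using less_LiminfD[OF q(2)] .
    then obtain R where R: "\<And>t. R \<le> \<bar>t\<bar> \<Longrightarrow> q < ereal (a t)"
      by (auto simp: eventually_at_infinity)
    have "q < \<infinity>" using R[OF abs_ge_self] by (rule less_trans) simp
    then obtain q' where q': "q = ereal q'" using q(1) by (cases q) auto
    show ?thesis
      by (rule that[of q' "\<bar>R\<bar>"]) (use q q' R in \<open>force intro: less_imp_le\<close>)+
  qed
  have sm: "0 < sqrt m" "sqrt m < sqrt m2" using m m2 by auto

  \<comment> \<open>Linear behaviour of the force near the wells\<close>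
  obtain d1 where d1: "d1 > 0" "\<And>\<xi>. \<bar>\<xi> - 1\<bar> < d1 \<Longrightarrow> \<bar>W \<xi> - (\<xi> - 1) * W2 1\<bar> \<le> W2 1 / 2 * \<bar>\<xi> - 1\<bar>"
    using sign_near_nondegenerate_zero[OF dW W_wells(2)] V_nondeg by (auto simp: W_def W2_def)
  obtain d2 where d2: "d2 > 0" "\<And>\<xi>. \<bar>\<xi> - (-1)\<bar> < d2 \<Longrightarrow> \<bar>W \<xi> - (\<xi> - (-1)) * W2 (-1)\<bar> \<le> W2 (-1) / 2 * \<bar>\<xi> - (-1)\<bar>"
    using sign_near_nondegenerate_zero[OF dW W_wells(1)] V_nondeg by (auto simp: W_def W2_def)
  define \<eta>1 where "\<eta>1 = min (1 / 2) (min (d1 / 2) (d2 / 2))"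
  have \<eta>1: "0 < \<eta>1" "\<eta>1 < 1" "\<eta>1 < d1" "\<eta>1 < d2" using d1 d2 by (auto simp: \<eta>1_def)
  define k where "k = min (W2 1) (W2 (-1)) / 2"
  have k: "k > 0" using V_nondeg by (simp add: k_def W2_def W_def)
  have Wr: "k * (1 - \<xi>) \<le> - W \<xi>" if "1 - \<eta>1 \<le> \<xi>" "\<xi> \<le> 1" for \<xi>
  proof -
    have "\<bar>W \<xi> - (\<xi> - 1) * W2 1\<bar> \<le> W2 1 / 2 * \<bar>\<xi> - 1\<bar>" using that \<eta>1 by (intro d1) auto
    moreover have "\<bar>\<xi> - 1\<bar> = 1 - \<xi>" using that by simp
    ultimately have "W \<xi> - (\<xi> - 1) * W2 1 \<le> W2 1 / 2 * (1 - \<xi>)" by (metis abs_le_D1)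
    then have "W2 1 / 2 * (1 - \<xi>) \<le> - W \<xi>" by (simp add: field_simps)
    moreover have "k * (1 - \<xi>) \<le> W2 1 / 2 * (1 - \<xi>)" using that by (intro mult_right_mono) (auto simp: k_def)
    ultimately show ?thesis by linarith
  qed
  have Wl: "k * (1 + \<xi>) \<le> W \<xi>" if "\<xi> \<le> -1 + \<eta>1" "-1 \<le> \<xi>" for \<xi>
  proof -
    have "\<bar>W \<xi> - (\<xi> - (-1)) * W2 (-1)\<bar> \<le> W2 (-1) / 2 * \<bar>\<xi> - (-1)\<bar>" using that \<eta>1 by (intro d2) auto
    moreover have "\<bar>\<xi> - (-1)\<bar> = 1 + \<xi>" using that by simp
    ultimately have "- (W \<xi> - (\<xi> - (-1)) * W2 (-1)) \<le> W2 (-1) / 2 * (1 + \<xi>)" by (metis abs_le_D2)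
    then have "W2 (-1) / 2 * (1 + \<xi>) \<le> W \<xi>" by (simp add: field_simps)
    moreover have "k * (1 + \<xi>) \<le> W2 (-1) / 2 * (1 + \<xi>)" using that by (intro mult_right_mono) (auto simp: k_def)
    ultimately show ?thesis by linarith
  qed
  \<comment> \<open>This linear bound on all of [-1,1] feeds the uniqueness argument at the
    equilibria.\<close>
  have W_lin: "\<bar>W \<xi>\<bar> \<le> C * \<bar>\<xi> - p\<bar>" if "\<bar>\<xi>\<bar> \<le> 1" "p = 1 \<or> p = -1" for \<xi> p
  proof -
    have "norm (W \<xi> - W p) \<le> C * norm (\<xi> - p)"
      by (rule field_differentiable_bound[of "{-1..1}"])
        (use that C in \<open>auto intro!: DERIV_subset[OF dW] simp: abs_le_iff\<close>)
    then show ?thesis using that W_wells by auto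
  qed

  \<comment> \<open>Action thresholds and the constants chosen from the gap\<close>
  define \<sigma> where "\<sigma> = G 1 - G (-1)"
  have \<sigma>: "\<sigma> > 0" using Gstrict[of "-1" 1] by (simp add: \<sigma>_def)
  \<comment> \<open>The cheapest ideal bad path: a crossing at level \<open>m2\<close>, or a
    crossing at level \<open>m\<close> together with a return trip between a well and distance
    \<open>\<eta>1\<close> from it.\<close>
  define thr where "thr = min (sqrt m2 * \<sigma>) (min (sqrt m * (\<sigma> + 2 * (G 1 - G (1 - \<eta>1)))) (sqrt m * (\<sigma> + 2 * (G (-1 + \<eta>1) - G (-1)))))"
  have thr: "sqrt m * \<sigma> < thr"
    using sm \<sigma> \<eta>1 Gstrict[of "1 - \<eta>1" 1] Gstrict[of "-1" "-1 + \<eta>1"] by (simp add: thr_def)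
  \<comment> \<open>\<open>U'\<close> will bound the action of the minimizers; the slack up to
    \<open>U\<close> absorbs the discretization factor, and the slack from \<open>U\<close> to
    \<open>thr\<close> the fact that wells are reached only within \<open>\<eta>\<close>.\<close>
  obtain U where U: "sqrt m * \<sigma> < U" "U < thr" using dense[OF thr] by blast
  obtain U' where U': "sqrt m * \<sigma> < U'" "U' < U" using dense[OF U(1)] by blast
  have U'0: "U' > 0" using U'(1) sm \<sigma> by (smt (verit) mult_pos_pos)
  \<comment> \<open>A loss of \<open>\<omega>\<close> in \<open>G\<close> costs at most a third of
    the slack at either level; it occurs once in \<open>T1\<close> and \<open>T2\<close>, twice in
    \<open>T3\<close> and \<open>T4\<close>.\<close>
  define \<omega> where "\<omega> = (thr - U) / (3 * sqrt m2)"
  have \<omega>: "\<omega> > 0" using U sm by (simp add: \<omega>_def)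
  have \<omega>m: "sqrt m2 * \<omega> = (thr - U) / 3" using sm by (simp add: \<omega>_def)
  have \<omega>m': "sqrt m * \<omega> \<le> (thr - U) / 3" unfolding \<omega>m[symmetric] using sm \<omega> by simp
  obtain \<eta> where \<eta>: "0 < \<eta>" "\<eta> \<le> \<eta>1" and G\<eta>: "G 1 - G (1 - \<eta>) < \<omega>" "G (-1 + \<eta>) - G (-1) < \<omega>"
  proof -
    have "((\<lambda>\<eta>. G 1 - G (1 - \<eta>)) \<longlongrightarrow> G 1 - G (1 - 0)) (at_right 0)"
      "((\<lambda>\<eta>. G (-1 + \<eta>) - G (-1)) \<longlongrightarrow> G (-1 + 0) - G (-1)) (at_right 0)"
      by (intro tendsto_intros isCont_tendsto_compose[OF DERIV_isCont[OF dG]])+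
    then have "eventually (\<lambda>\<eta>. G 1 - G (1 - \<eta>) < \<omega>) (at_right 0)"
      "eventually (\<lambda>\<eta>. G (-1 + \<eta>) - G (-1) < \<omega>) (at_right 0)"
      using \<omega> by (auto dest!: order_tendstoD(2)[of _ _ _ \<omega>])
    moreover have "eventually (\<lambda>\<eta>. 0 < \<eta> \<and> \<eta> < \<eta>1) (at_right 0)"
      using \<eta>1 by (auto simp: eventually_at_right_field)
    ultimately have "eventually (\<lambda>\<eta>. (0 < \<eta> \<and> \<eta> < \<eta>1) \<and> G 1 - G (1 - \<eta>) < \<omega> \<and> G (-1 + \<eta>) - G (-1) < \<omega>) (at_right 0)"
      by eventually_elim blast
    then obtain \<eta> where "(0 < \<eta> \<and> \<eta> < \<eta>1) \<and> G 1 - G (1 - \<eta>) < \<omega> \<and> G (-1 + \<eta>) - G (-1) < \<omega>"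
      using eventually_happens'[OF trivial_limit_at_right_real] by blast
    then show ?thesis by (intro that[of \<eta>]) auto
  qed
  have gap2: "U \<le> sqrt m2 * (\<sigma> - \<omega>)"
  proof -
    have "sqrt m2 * (\<sigma> - \<omega>) = sqrt m2 * \<sigma> - (thr - U) / 3" by (simp add: right_diff_distrib \<omega>m)
    moreover have "thr \<le> sqrt m2 * \<sigma>" by (simp add: thr_def)
    then have "U \<le> sqrt m2 * \<sigma> - (thr - U) / 3" using U(2) by argo
    ultimately show ?thesis by simp
  qed
  have gap: "U \<le> sqrt m * (A - 2 * \<omega>)" if "thr \<le> sqrt m * A" for A
  proof -
    have "sqrt m * (A - 2 * \<omega>) = sqrt m * A - 2 * (sqrt m * \<omega>)" by (simp add: algebra_simps)
    moreover have "U \<le> sqrt m * A - 2 * (sqrt m * \<omega>)" using that U(2) \<omega>m' by argo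
    ultimately show ?thesis by simp
  qed
  have T1: "U \<le> sqrt m2 * (G 1 - G (-1 + \<eta>))"
  proof -
    have "sqrt m2 * (\<sigma> - \<omega>) \<le> sqrt m2 * (G 1 - G (-1 + \<eta>))"
      using G\<eta> sm by (intro mult_left_mono) (auto simp: \<sigma>_def)
    then show ?thesis using gap2 by (rule order_trans[rotated])
  qed
  have T2: "U \<le> sqrt m2 * (G (1 - \<eta>) - G (-1))"
  proof -
    have "sqrt m2 * (\<sigma> - \<omega>) \<le> sqrt m2 * (G (1 - \<eta>) - G (-1))"
      using G\<eta> sm by (intro mult_left_mono) (auto simp: \<sigma>_def)
    then show ?thesis using gap2 by (rule order_trans[rotated])
  qed
  have T3: "U \<le> sqrt m * ((G (1 - \<eta>) - G (-1)) + (G (1 - \<eta>) - G (1 - \<eta>1)) + (G 1 - G (1 - \<eta>1)))"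
  proof -
    have "sqrt m * ((\<sigma> + 2 * (G 1 - G (1 - \<eta>1))) - 2 * \<omega>)
      \<le> sqrt m * ((G (1 - \<eta>) - G (-1)) + (G (1 - \<eta>) - G (1 - \<eta>1)) + (G 1 - G (1 - \<eta>1)))"
      using G\<eta> sm by (intro mult_left_mono) (auto simp: \<sigma>_def)
    moreover have "thr \<le> sqrt m * (\<sigma> + 2 * (G 1 - G (1 - \<eta>1)))" by (simp add: thr_def)
    ultimately show ?thesis using gap by (meson order_trans)
  qed
  have T4: "U \<le> sqrt m * ((G (-1 + \<eta>1) - G (-1)) + (G (-1 + \<eta>1) - G (-1 + \<eta>)) + (G 1 - G (-1 + \<eta>)))"
  proof -
    have "sqrt m * ((\<sigma> + 2 * (G (-1 + \<eta>1) - G (-1))) - 2 * \<omega>)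
      \<le> sqrt m * ((G (-1 + \<eta>1) - G (-1)) + (G (-1 + \<eta>1) - G (-1 + \<eta>)) + (G 1 - G (-1 + \<eta>)))"
      using G\<eta> sm by (intro mult_left_mono) (auto simp: \<sigma>_def)
    moreover have "thr \<le> sqrt m * (\<sigma> + 2 * (G (-1 + \<eta>1) - G (-1)))" by (simp add: thr_def)
    ultimately show ?thesis using gap by (meson order_trans)
  qed
  obtain v where v: "v > 0" "\<And>\<xi>. \<bar>\<xi>\<bar> \<le> 1 - \<eta> \<Longrightarrow> v \<le> V \<xi>"
  proof -
    obtain c where c: "c \<in> {-1 + \<eta>..1 - \<eta>}" "\<And>\<xi>. \<xi> \<in> {-1 + \<eta>..1 - \<eta>} \<Longrightarrow> V c \<le> V \<xi>"
      using continuous_attains_inf[of "{-1 + \<eta>..1 - \<eta>}" V] continuous_on_subset[OF cV] \<eta> \<eta>1 by auto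
    show ?thesis by (rule that[of "V c"]) (use c \<eta> V_pos in \<open>auto simp: abs_le_iff\<close>)
  qed
  \<comment> \<open>Waiting time after which a path away from the wells has overspent; the surplus
    leaves room for a mesh of size up to 1.\<close>
  define L where "L = U' / (m * v) + 2"
  have L: "1 < L" "U' < (L - 1) * m * v"
  proof -
    have "0 < m * v" using m v(1) by simp
    then show "1 < L" using U'0 by (simp add: L_def add_pos_pos)
    have "(L - 1) * m * v = U' + m * v" using m v(1) by (simp add: L_def field_simps)
    then show "U' < (L - 1) * m * v" using \<open>0 < m * v\<close> by simp
  qed

  \<comment> \<open>Parameters of the competitor and the choice of
    \<open>\<epsilon>s\<close>\<close>
  define \<tau> where "\<tau> = (U' - sqrt m * \<sigma>) / (2 * (\<sigma> + 2))"
  have \<tau>: "\<tau> > 0" using U' \<sigma> by (simp add: \<tau>_def)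
  \<comment> \<open>The same \<open>\<tau>\<close> raises the level and supplies the extra speed.
    The added cost \<open>\<tau> * (\<sigma> + 2)\<close> is half of the room below
    \<open>U'\<close>, so the terms of order \<open>h\<close> still fit.\<close>
  define \<beta> where "\<beta> = sqrt m + \<tau>"
  have \<beta>: "\<beta> > sqrt m" "\<beta> \<ge> 0" using \<tau> sm by (auto simp: \<beta>_def)
  have \<beta>\<sigma>: "\<beta> * \<sigma> + 2 * \<tau> < U'"
  proof -
    have "\<beta> * \<sigma> + 2 * \<tau> = sqrt m * \<sigma> + \<tau> * (\<sigma> + 2)" by (simp add: \<beta>_def algebra_simps)
    also have "\<tau> * (\<sigma> + 2) = (U' - sqrt m * \<sigma>) / 2" using \<sigma> by (simp add: \<tau>_def field_simps)
    finally show ?thesis using U'(1) by argo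
  qed
  have "m < \<beta>\<^sup>2"
  proof -
    have "(sqrt m)\<^sup>2 < \<beta>\<^sup>2" using \<beta> sm by (intro power_strict_mono) auto
    then show ?thesis using m by simp
  qed
  then obtain r where r: "r > 0" "\<And>t. \<bar>t\<bar> < r \<Longrightarrow> a t < \<beta>\<^sup>2"
  proof -
    have "isCont a 0" using a_cont by (simp add: continuous_on_eq_continuous_at)
    then have "eventually (\<lambda>t. a t < \<beta>\<^sup>2) (nhds 0)"
      using \<open>m < \<beta>\<^sup>2\<close> unfolding isCont_def m_def
      by (metis order_tendstoD(2) tendsto_at_iff_tendsto_nhds)
    then show ?thesis using that by (auto simp: eventually_nhds_metric)
  qed
  \<comment> \<open>During a crossing of length \<open>2 / \<tau>\<close> the slow time then stays
    below \<open>r\<close>, where \<open>a < \<beta>\<^sup>2\<close>.\<close>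
  define \<epsilon>s where "\<epsilon>s = r * \<tau> / 2"
  have \<epsilon>s: "\<epsilon>s > 0" using r \<tau> by (simp add: \<epsilon>s_def)
  define M where "M = \<beta> * S + \<tau>"

  have "\<exists>x :: real \<Rightarrow> real. C2 x
              \<and> (\<forall>t. deriv (deriv x) t = a (\<epsilon> * t) * deriv V (x t))
              \<and> (x \<longlongrightarrow> -1) at_bot \<and> (x \<longlongrightarrow> 1) at_top
              \<and> (\<forall>t. -1 < x t \<and> x t < 1)" if \<epsilon>: "0 < \<epsilon>" "\<epsilon> < \<epsilon>s" for \<epsilon>
  proof -

    \<comment> \<open>Grid minimizers for a fixed \<open>\<epsilon>\<close>\<close>
    define b where "b t = a (\<epsilon> * t)" for t
    define R' where "R' = R / \<epsilon>"
    have R': "R' \<ge> 0" using R \<epsilon> by (simp add: R'_def)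
    have b2: "m2 \<le> b t" if "R' \<le> \<bar>t\<bar>" for t
      unfolding b_def using that \<epsilon> by (intro a2) (simp add: R'_def abs_mult field_simps)
    have bm: "m \<le> b t" for t by (simp add: b_def am)
    have bb: "\<bar>b t\<bar> \<le> B" for t by (simp add: b_def B)
    have cb: "continuous_on UNIV b"
      unfolding b_def by (intro continuous_on_compose2[OF a_cont] continuous_intros) auto
    define h where "h n = 1 / real (Suc n)" for n
    have h: "h n > 0" "h n \<le> 1" for n by (auto simp: h_def)
    define bd where "bd n i = b (of_int i / real (Suc n))" for n i
    define N where "N n = (int (Suc n))\<^sup>2" for n
    have N: "N n > 0" for n by (simp add: N_def)
    define act where "act n x = (\<Sum>i\<in>{-N n..<N n}. step_action (h n) (bd n) V x i)" for n x
    have "\<forall>n. \<exists>x. x \<in> grid_paths (N n) \<and> (\<forall>y\<in>grid_paths (N n). act n x \<le> act n y)"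
      unfolding act_def using grid_minimizer_exists[OF N cV] by metis
    then obtain X where X: "\<And>n. X n \<in> grid_paths (N n)" and Xmin: "\<And>n y. y \<in> grid_paths (N n) \<Longrightarrow> act n (X n) \<le> act n y"
      by metis
    have EL: "X n (i + 1) - 2 * X n i + X n (i - 1) = (1 / real (Suc n))\<^sup>2 * b (of_int i / real (Suc n)) * W (X n i)"
      if "\<bar>i\<bar> < (int (Suc n))\<^sup>2" for n i
      using grid_minimizer_Euler_Lagrange[OF X Xmin[unfolded act_def] dV W_wells h(1), of n i] that
      by (simp only: N_def h_def bd_def)
    \<comment> \<open>The condition on \<open>n\<close> says that the right half of the window, of
      length n+1, suffices for the competitor to arrive at 1.\<close>
    have upper: "act n (X n) \<le> \<beta> * \<sigma> + 2 * \<tau> + h n * (2 * (\<beta> * K * M) + M\<^sup>2)" if n: "2 \<le> real (Suc n) * \<tau>" for n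
    proof -
      have Nh: "2 \<le> of_int (N n) * h n * \<tau>" using n by (simp add: N_def h_def power2_eq_square)
      have bs: "bd n i \<le> \<beta>\<^sup>2" if i: "0 \<le> i" "of_int i * h n * \<tau> < 2" for i
      proof -
        have "of_int i * h n < 2 / \<tau>" using i \<tau> by (simp add: field_simps)
        then have "\<epsilon> * (of_int i * h n) \<le> \<epsilon> * (2 / \<tau>)" using \<epsilon> by (intro mult_left_mono) auto
        also have "\<dots> < \<epsilon>s * (2 / \<tau>)" using \<epsilon> \<tau> by (intro mult_strict_right_mono) auto
        also have "\<dots> = r" using \<tau> by (simp add: \<epsilon>s_def)
        finally have "\<bar>\<epsilon> * (of_int i * h n)\<bar> < r" using i \<epsilon> h(1)[of n] by simp
        from r(2)[OF this] show ?thesis by (simp add: bd_def b_def h_def)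
      qed
      have SM: "\<beta> * sqrt (2 * V \<xi>) + \<tau> \<le> M" if "\<bar>\<xi>\<bar> \<le> 1" for \<xi>
        using S[OF that] \<beta> by (simp add: M_def s_def mult_left_mono)
      have "\<exists>y\<in>grid_paths (N n). act n y \<le> \<beta> * (G 1 - G (-1)) + 2 * \<tau> + h n * (2 * (\<beta> * K * M) + M\<^sup>2)"
        unfolding act_def
        by (rule competitor_action[OF V0 V_wells G Gmono SM h(1) K \<beta>(2) \<tau> N Nh bs]) assumption+
      then show ?thesis using Xmin by (force simp: \<sigma>_def)
    qed
    have hlim: "h \<longlonglongrightarrow> 0"
      unfolding h_def using LIMSEQ_inverse_real_of_nat by (simp add: inverse_eq_divide)
    have "((\<lambda>n. \<beta> * \<sigma> + 2 * \<tau> + h n * (2 * (\<beta> * K * M) + M\<^sup>2)) \<longlongrightarrow> \<beta> * \<sigma> + 2 * \<tau> + 0 * (2 * (\<beta> * K * M) + M\<^sup>2)) sequentially"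
      by (intro tendsto_intros hlim)
    then have ev1: "eventually (\<lambda>n. \<beta> * \<sigma> + 2 * \<tau> + h n * (2 * (\<beta> * K * M) + M\<^sup>2) < U') sequentially"
      using \<beta>\<sigma> by (intro order_tendstoD(2)) auto
    have "((\<lambda>n. (1 + 2 * h n * K * sqrt m2) * U') \<longlongrightarrow> (1 + 2 * 0 * K * sqrt m2) * U') sequentially"
      by (intro tendsto_intros hlim)
    then have ev2: "eventually (\<lambda>n. (1 + 2 * h n * K * sqrt m2) * U' < U) sequentially"
      using U' by (intro order_tendstoD(2)) auto
    have "((\<lambda>n. 2 * h n) \<longlongrightarrow> 2 * 0) sequentially"
      by (intro tendsto_intros hlim)
    then have "eventually (\<lambda>n. 2 * h n < \<tau>) sequentially"
      using \<tau> by (intro order_tendstoD(2)) auto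
    then have ev3: "eventually (\<lambda>n. 2 \<le> real (Suc n) * \<tau>) sequentially"
      by eventually_elim (simp add: h_def field_simps)

    \<comment> \<open>Localization of the transition, uniformly in the mesh\<close>
    define T where "T = R' + L"
    have ev: "eventually (\<lambda>n. (\<forall>i. T * real (Suc n) \<le> of_int i \<longrightarrow> 1 - \<eta>1 \<le> X n i)
        \<and> (\<forall>i. of_int i \<le> - T * real (Suc n) \<longrightarrow> X n i \<le> -1 + \<eta>1)) sequentially"
      using ev1 ev2 ev3
    proof eventually_elim
      case (elim n)
      have act: "(\<Sum>i\<in>{-N n..<N n}. step_action (h n) (bd n) V (X n) i) \<le> U'"
        using upper[OF elim(3)] elim(1) by (simp add: act_def)
      have Lh: "h n < L" "U' < (L - h n) * m * v"
      proof -
        show "h n < L" using h(2)[of n] L by simp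
        have "(L - 1) * m * v \<le> (L - h n) * m * v" using h(2)[of n] m v by (intro mult_right_mono) auto
        then show "U' < (L - h n) * m * v" using L by simp
      qed
      have bd2: "m2 \<le> bd n i" if "R' \<le> \<bar>of_int i * h n\<bar>" for i
        unfolding bd_def using that by (intro b2) (simp add: h_def)
      have bdm: "m \<le> bd n i" for i by (simp add: bd_def bm)
      note loc = low_action_localized[OF X h(1) K V0 G Gmono m less_imp_le[OF m2] bdm bd2 R' act elim(2)
          \<eta> \<eta>1(2) v(2) Lh T1 T2 T3 T4]
      have eq: "of_int i * h n = of_int i / real (Suc n)" for i by (simp add: h_def)
      show ?case
        using loc unfolding eq T_def
        by (simp add: pos_le_divide_eq pos_divide_le_eq)
    qed

    \<comment> \<open>Passage to the limit and regularity of the solution\<close>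
    obtain x where xb: "\<And>t. \<bar>x t\<bar> \<le> 1" and xc: "continuous_on UNIV x"
      and sym: "\<And>t \<rho>. \<rho> > 0 \<Longrightarrow> \<exists>r>0. \<forall>s. 0 < s \<and> s < r \<longrightarrow>
         \<bar>x (t + s) + x (t - s) - 2 * x t - b t * W (x t) * s\<^sup>2\<bar> \<le> \<rho> * s\<^sup>2"
      and xr: "\<forall>t\<ge>T+1. 1 - \<eta>1 \<le> x t" and xl: "\<forall>t\<le>-T-1. x t \<le> -1 + \<eta>1"
    proof (rule discrete_solutions_limit[of X b W B, OF _ EL cb bb cW])
      show "\<bar>X n i\<bar> \<le> 1" for n i using X by (simp add: grid_paths_def)
      fix x :: "real \<Rightarrow> real"
      assume 1: "\<And>t. \<bar>x t\<bar> \<le> 1" "continuous_on UNIV x"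
        "\<And>t \<rho>. \<rho> > 0 \<Longrightarrow> \<exists>r>0. \<forall>s. 0 < s \<and> s < r \<longrightarrow>
         \<bar>x (t + s) + x (t - s) - 2 * x t - b t * W (x t) * s\<^sup>2\<bar> \<le> \<rho> * s\<^sup>2"
        and r: "\<And>R c. eventually (\<lambda>n. \<forall>i. of_int i \<ge> R * real (Suc n) \<longrightarrow> c \<le> X n i) sequentially
          \<Longrightarrow> \<forall>t\<ge>R+1. c \<le> x t"
        and l: "\<And>R c. eventually (\<lambda>n. \<forall>i. of_int i \<le> - R * real (Suc n) \<longrightarrow> X n i \<le> c) sequentially
          \<Longrightarrow> \<forall>t\<le>-R-1. x t \<le> c"
      show thesis
        by (rule that[OF 1 r l]) (use ev in \<open>auto elim: eventually_mono\<close>)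
    qed
    define f where "f t = b t * W (x t)" for t
    have cf: "continuous_on UNIV f"
      unfolding f_def by (intro continuous_intros cb continuous_on_compose2[OF cW] xc) auto
    obtain x' where x': "\<And>t. (x has_real_derivative x' t) (at t)" "\<And>t. (x' has_real_derivative f t) (at t)"
      using symmetric_second_derivative_imp_second_derivative[OF xc cf sym[folded f_def]] by blast
    have dx: "deriv x = x'" using x'(1) DERIV_imp_deriv by blast
    have ddx: "deriv (deriv x) = f" unfolding dx using x'(2) DERIV_imp_deriv by blast
    have C2x: "C2 x"
      unfolding C2_def using x' cf dx ddx by (auto simp: real_differentiable_def)
    have xb': "-1 \<le> x t" "x t \<le> 1" for t using xb[of t] by auto

    \<comment> \<open>Limits at infinity\<close>
    have "((\<lambda>t. 1 - x t) \<longlongrightarrow> 0) at_top"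
    proof (rule bounded_strongly_convex_tendsto_zero)
      show "((\<lambda>t. 1 - x t) has_real_derivative - x' t) (at t)" "((\<lambda>t. - x' t) has_real_derivative - f t) (at t)" for t
        by (auto intro!: derivative_eq_intros x')
      show "0 \<le> 1 - x t" "1 - x t \<le> 2" for t using xb'[of t] by auto
      show "m * k > 0" using m k by simp
      fix t assume "T + 1 \<le> t"
      then have w: "k * (1 - x t) \<le> - W (x t)" using xr xb' by (intro Wr) auto
      have "m * (k * (1 - x t)) \<le> b t * (- W (x t))"
        by (rule mult_mono) (use w bm[of t] m k xb'[of t] in auto)
      then show "m * k * (1 - x t) \<le> - f t" by (simp add: f_def mult.assoc)
    qed
    from tendsto_diff[OF tendsto_const[of 1] this] have lim_top: "(x \<longlongrightarrow> 1) at_top" by simp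
    have "((\<lambda>t. 1 + x (- t)) \<longlongrightarrow> 0) at_top"
    proof (rule bounded_strongly_convex_tendsto_zero)
      show "((\<lambda>t. 1 + x (- t)) has_real_derivative - x' (- t)) (at t)"
        "((\<lambda>t. - x' (- t)) has_real_derivative f (- t)) (at t)" for t
        by (auto intro!: derivative_eq_intros DERIV_chain2[OF x'(1)] DERIV_chain2[OF x'(2)])
      show "0 \<le> 1 + x (- t)" "1 + x (- t) \<le> 2" for t using xb'[of "- t"] by auto
      show "m * k > 0" using m k by simp
      fix t assume "T + 1 \<le> t"
      then have w: "k * (1 + x (- t)) \<le> W (x (- t))" using xl xb' by (intro Wl) auto
      have "m * (k * (1 + x (- t))) \<le> b (- t) * W (x (- t))"
        by (rule mult_mono) (use w bm[of "- t"] m k xb'[of "- t"] in auto)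
      then show "m * k * (1 + x (- t)) \<le> f (- t)" by (simp add: f_def mult.assoc)
    qed
    from tendsto_diff[OF this tendsto_const[of 1]] have "((\<lambda>t. x (- t)) \<longlongrightarrow> -1) at_top" by simp
    then have lim_bot: "(x \<longlongrightarrow> -1) at_bot" by (simp add: filterlim_at_bot_mirror)

    \<comment> \<open>Strict confinement between the wells\<close>
    have avoid: "x t \<noteq> p" if p: "p = 1 \<or> p = -1" for t p
    proof
      assume xt: "x t = p"
      have x'0: "x' t = 0"
        using p DERIV_local_max[OF x'(1), of 1 t] DERIV_local_min[OF x'(1), of 1 t] xb' xt by auto
      have "x u - p = 0" for u
      \<comment> \<open>Touching \<open>p\<close> is an extremum of \<open>x\<close>, so
        \<open>x\<close> shares value and slope at \<open>t\<close> with the constant solution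
        \<open>p\<close> and must coincide with it; a constant cannot lie near -1 early and near 1
        late.\<close>
      proof (rule second_order_linear_growth_unique[of "\<lambda>u. x u - p" x' f "B * C" t])
        show "((\<lambda>u. x u - p) has_real_derivative x' u) (at u)" "(x' has_real_derivative f u) (at u)" for u
          using x' by (auto intro!: derivative_eq_intros)
        show "\<bar>f u\<bar> \<le> B * C * \<bar>x u - p\<bar>" for u
        proof -
          have "\<bar>b u\<bar> * \<bar>W (x u)\<bar> \<le> B * (C * \<bar>x u - p\<bar>)"
            using bb[of u] W_lin[OF xb p] order_trans[OF abs_ge_zero bb] by (intro mult_mono) auto
          then show ?thesis by (simp add: f_def abs_mult mult.assoc)
        qed
        show "B * C \<ge> 0" using C order_trans[OF abs_ge_zero bb] by simp
      qed (use xt x'0 in auto)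
      then have const: "x u = p" for u by simp
      have "x (- T - 1) \<le> -1 + \<eta>1" "1 - \<eta>1 \<le> x (T + 1)" using xr xl by auto
      then have "1 - \<eta>1 \<le> -1 + \<eta>1" unfolding const by (rule order_trans[rotated])
      then show False using \<eta>1(2) by simp
    qed
    have "x t \<noteq> 1" "x t \<noteq> -1" for t using avoid by metis+
    then have inside: "-1 < x t \<and> x t < 1" for t
      using xb'[of t] by (simp add: order.strict_iff_order eq_commute[of "-1"])
    have ode: "deriv (deriv x) t = a (\<epsilon> * t) * deriv V (x t)" for t
      by (simp add: ddx f_def b_def W_def)
    show ?thesis
      by (intro exI[of _ x] conjI allI C2x ode lim_bot lim_top) (simp_all add: inside)
  qed
  then show ?thesis using \<epsilon>s by (intro exI[of _ \<epsilon>s] conjI allI impI) (assumption, erule conjE, assumption)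
qed

end
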